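(* Temporal Hamiltonian Path can be solved in time $(n\Lambda)^{O(1)}3^{O(\phi^3)}$, where the input temporal graph has $n$ vertices, lifetime $\Lambda$ and TIM width $\phi$.
   Context: A temporal graph $\mathcal{G}=(G,\lambda)$: static graph $G=(V,E)$ and $\lambda:E\to 2^{\mathbb{N}}$; time-edges $(e,t)$ with $t\in\lambda(e)$; lifetime $\Lambda=\max_e\max\lambda(e)$. A (strict) temporal path is a sequence of time-edges $(e_0,t_0),\dots,(e_l,t_l)$ forming a walk in $G$ with $t_i<t_{i+1}$, each vertex traversed at most once. Temporal Hamiltonian Path: given $\mathcal{G}$, decide whether there is a temporal path containing every vertex. TIM decomposition: triple $(T,B,\tau)$, $T$ a directed tree, bags $B(s)\subseteq V$, $\tau$ assigning each bag a time in $[\Lambda]$, such that (1) each vertex $v$ and time $t\in[\Lambda]$ lies in exactly one bag labelled $t$; (2) each time-edge $(uv,t)$ has a unique node $i$ with $\{u,v\}\subseteq B(i)$, $\tau(B(i))=t$; (3) arcs of $T$ are exactly the pairs $(i,j)$ with $B(i)\cap B(j)\neq\emptyset$ and $\tau(B(j))=\tau(B(i))+1$. Width is the maximum bag size; TIM width is the minimum width over TIM decompositions. *)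

theory Defs
  imports Complex_Main "Graph_Theory.Graph_Theory"
begin

section \<open>Temporal graphs and temporal paths\<close>

text \<open>
  Only the values of \<open>labels\<close> on the edges matter.  Times are positive, since they have to lie
  in $[\Lambda] = \{1,\dots,\Lambda\}$.
\<close>

record 'v temporal_graph =
  vertices :: "'v set"
  edges :: "'v set set"
  labels :: "'v set \<Rightarrow> nat set"

definition is_temporal_graph :: "'v temporal_graph \<Rightarrow> bool" where
  "is_temporal_graph G \<longleftrightarrow>
     finite (vertices G) \<and>
     (\<forall>e\<in>edges G. e \<subseteq> vertices G \<and> card e = 2) \<and>
     (\<forall>e\<in>edges G. finite (labels G e) \<and> 0 \<notin> labels G e)"

definition time_edges :: "'v temporal_graph \<Rightarrow> ('v set \<times> nat) set" where
  "time_edges G = {(e, t). e \<in> edges G \<and> t \<in> labels G e}"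

text \<open>Unspecified if there is no time-edge.\<close>

definition lifetime :: "'v temporal_graph \<Rightarrow> nat" where
  "lifetime G = Max (snd ` time_edges G)"

text \<open>
  \<open>vs\<close> lists the vertices in the order in which the time-edges \<open>p\<close> traverse them.  The sequence
  \<open>p\<close> may be empty; the path then consists of a single vertex.
\<close>

definition temporal_path :: "'v temporal_graph \<Rightarrow> 'v list \<Rightarrow> ('v set \<times> nat) list \<Rightarrow> bool" where
  "temporal_path G vs p \<longleftrightarrow>
     length vs = Suc (length p) \<and> set vs \<subseteq> vertices G \<and> distinct vs \<and>
     set p \<subseteq> time_edges G \<and>
     (\<forall>i<length p. fst (p ! i) = {vs ! i, vs ! Suc i}) \<and>
     sorted_wrt (<) (map snd p)"

definition has_temporal_hamiltonian_path :: "'v temporal_graph \<Rightarrow> bool" where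
  "has_temporal_hamiltonian_path G \<longleftrightarrow> (\<exists>vs p. temporal_path G vs p \<and> set vs = vertices G)"


section \<open>TIM decompositions\<close>

text \<open>
  A directed tree is an orientation of an undirected tree.  This is not the library's
  \<^const>\<open>tree\<close>, which only forbids directed cycles.  A cycle of length at least 3 in the symmetric
  closure is a cycle of the underlying undirected graph, whereas a cycle of length 2 there runs
  back and forth along one edge.
\<close>

definition directed_tree :: "'i pair_pre_digraph \<Rightarrow> bool" where
  "directed_tree T \<longleftrightarrow>
     pair_fin_digraph T \<and>
     asym (parcs T) \<and>
     Digraph_Component.connected (with_proj T) \<and>
     \<not> (\<exists>c. pre_digraph.cycle (with_proj (mk_symmetric (with_proj T))) c \<and> 3 \<le> length c)"

definition TIM_decomposition ::
  "'v temporal_graph \<Rightarrow> 'i pair_pre_digraph \<Rightarrow> ('i \<Rightarrow> 'v set) \<Rightarrow> ('i \<Rightarrow> nat) \<Rightarrow> bool" where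
  "TIM_decomposition G T B \<tau> \<longleftrightarrow>
     directed_tree T \<and>
     (\<forall>i\<in>pverts T. B i \<subseteq> vertices G \<and> \<tau> i \<in> {1..lifetime G}) \<and>
     (\<forall>v\<in>vertices G. \<forall>t\<in>{1..lifetime G}. \<exists>!i. i \<in> pverts T \<and> v \<in> B i \<and> \<tau> i = t) \<and>
     (\<forall>(e, t)\<in>time_edges G. \<exists>!i. i \<in> pverts T \<and> e \<subseteq> B i \<and> \<tau> i = t) \<and>
     parcs T = {(i, j). i \<in> pverts T \<and> j \<in> pverts T \<and> B i \<inter> B j \<noteq> {} \<and> \<tau> j = \<tau> i + 1}"

definition TIM_decomposition_width :: "'i pair_pre_digraph \<Rightarrow> ('i \<Rightarrow> 'v set) \<Rightarrow> nat" where
  "TIM_decomposition_width T B = Max ((\<lambda>i. card (B i)) ` pverts T)"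

text \<open>
  The nodes of the (finite) tree may be taken to be natural numbers.  A temporal graph with a
  time-edge has a TIM decomposition, namely the directed path on \<open>{1..lifetime G}\<close> all of whose
  bags are \<open>vertices G\<close>.
\<close>

definition TIM_width :: "'v temporal_graph \<Rightarrow> nat" where
  "TIM_width G =
     (LEAST w. \<exists>(T :: nat pair_pre_digraph) B \<tau>.
        TIM_decomposition G T B \<tau> \<and> TIM_decomposition_width T B = w)"


section \<open>Random access machine programs\<close>

text \<open>
  The computation model is the unit-cost RAM with addition and (truncated) subtraction, but
  without multiplication, which makes it polynomially equivalent to Turing machines.  Programs are
  structured, and the memory is divided into named arrays of unbounded natural numbers.  An array
  cell is accessed at a computed index (indirect addressing); a scalar variable is an array of
  which only cell 0 is used.  A program mentions finitely many arrays, so they could be interleaved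
  in one memory at the cost of a constant factor.
\<close>

type_synonym state = "string \<Rightarrow> nat \<Rightarrow> nat"

datatype aexp = Num nat | Cell string aexp | Plus aexp aexp | Minus aexp aexp

datatype bexp = Less aexp aexp | Equal aexp aexp | Neg bexp | Conj bexp bexp

datatype com =
    Skip
  | Assign string aexp aexp
  | Seq com com
  | Cond bexp com com
  | While bexp com

fun aval :: "aexp \<Rightarrow> state \<Rightarrow> nat" where
  "aval (Num k) s = k"
| "aval (Cell x a) s = s x (aval a s)"
| "aval (Plus a b) s = aval a s + aval b s"
| "aval (Minus a b) s = aval a s - aval b s"

fun bval :: "bexp \<Rightarrow> state \<Rightarrow> bool" where
  "bval (Less a b) s \<longleftrightarrow> aval a s < aval b s"
| "bval (Equal a b) s \<longleftrightarrow> aval a s = aval b s"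
| "bval (Neg b) s \<longleftrightarrow> \<not> bval b s"
| "bval (Conj b c) s \<longleftrightarrow> bval b s \<and> bval c s"

fun acost :: "aexp \<Rightarrow> nat" where
  "acost (Num k) = 1"
| "acost (Cell x a) = 1 + acost a"
| "acost (Plus a b) = 1 + acost a + acost b"
| "acost (Minus a b) = 1 + acost a + acost b"

fun bcost :: "bexp \<Rightarrow> nat" where
  "bcost (Less a b) = 1 + acost a + acost b"
| "bcost (Equal a b) = 1 + acost a + acost b"
| "bcost (Neg b) = 1 + bcost b"
| "bcost (Conj b c) = 1 + bcost b + bcost c"

text \<open>
  \<open>exec c s t s'\<close>: started in state \<open>s\<close>, the program \<open>c\<close> terminates after exactly \<open>t\<close> steps in
  state \<open>s'\<close>.  The command \<open>Assign x a b\<close> stores the value of \<open>b\<close> in cell \<open>a\<close> of array \<open>x\<close>.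
\<close>

inductive exec :: "com \<Rightarrow> state \<Rightarrow> nat \<Rightarrow> state \<Rightarrow> bool" where
  Skip: "exec Skip s 1 s"
| Assign: "exec (Assign x a b) s (1 + acost a + acost b) (s(x := (s x)(aval a s := aval b s)))"
| Seq: "exec c1 s1 t1 s2 \<Longrightarrow> exec c2 s2 t2 s3 \<Longrightarrow> exec (Seq c1 c2) s1 (t1 + t2) s3"
| CondTrue: "bval b s \<Longrightarrow> exec c1 s t s' \<Longrightarrow> exec (Cond b c1 c2) s (1 + bcost b + t) s'"
| CondFalse: "\<not> bval b s \<Longrightarrow> exec c2 s t s' \<Longrightarrow> exec (Cond b c1 c2) s (1 + bcost b + t) s'"
| WhileFalse: "\<not> bval b s \<Longrightarrow> exec (While b c) s (1 + bcost b) s"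
| WhileTrue: "bval b s1 \<Longrightarrow> exec c s1 t1 s2 \<Longrightarrow> exec (While b c) s2 t2 s3 \<Longrightarrow>
    exec (While b c) s1 (1 + bcost b + t1 + t2) s3"


section \<open>Instances as inputs of programs\<close>

text \<open>
  The vertices of an instance with \<open>n\<close> vertices are \<open>0, \<dots>, n - 1\<close>.  The input lists the number of
  vertices, the number of edges, and then for every edge its two endpoints, the number of its
  labels, and its labels.  The order of the edges, of the endpoints of an edge and of the labels of
  an edge is arbitrary.
\<close>

definition encodes :: "nat list \<Rightarrow> nat temporal_graph \<Rightarrow> bool" where
  "encodes xs G \<longleftrightarrow>
     (\<exists>n (es :: (nat \<times> nat \<times> nat list) list).
        vertices G = {..<n} \<and>
        edges G = (\<lambda>(u, v, ts). {u, v}) ` set es \<and>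
        distinct (map (\<lambda>(u, v, ts). {u, v}) es) \<and>
        (\<forall>(u, v, ts)\<in>set es. distinct ts \<and> set ts = labels G {u, v}) \<and>
        xs = n # length es # concat (map (\<lambda>(u, v, ts). u # v # length ts # ts) es))"

definition input_state :: "nat list \<Rightarrow> state" where
  "input_state xs = (\<lambda>x i. if x = ''input'' \<and> i < length xs then xs ! i else 0)"

definition result :: "state \<Rightarrow> nat" where
  "result s = s ''output'' 0"

end

(*
  A temporal path that is at x at time t and has visited V can only be completed to a Hamiltonian
  one if every unvisited vertex is still reachable from (x, t) by a temporal walk.  The program
  explores all configurations (x, t, V) and drops those that fail this test; it never computes a
  decomposition.  In a TIM decomposition, a vertex v that leads to (x, t) and is reachable from it
  lies in the bag of x at time t: otherwise the bags of v and the detour through the bag of x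
  would be two different directed paths with the same ends, hence a cycle in the tree.  So V is
  determined by its intersection with one bag, and there are at most 2^phi configurations that
  survive for each (x, t), instead of 2^n.
*)

theory Submission
  imports Defs "HOL-Library.Nat_Bijection"
begin

section \<open>Uniqueness of directed paths and existence of TIM decompositions\<close>

text \<open>The reachability test is a tolerant one. Correctness asks that it keep every
  configuration that a Hamiltonian path passes through, so the reachable sets may be too large; the
  width bound asks that reachability follow directed paths of the tree, and several moves at the
  same time t stay within one bag. Hence a single pass over the arc list per time step is precise
  enough. Configurations that fail the test are still generated and stored. Except for the root,
  each is the child of a survivor along one arc, so storing them costs a factor of the number of
  arcs. Each insertion scans the queue for duplicates, which makes the time quadratic in the number
  of configurations. This is the origin of (2^phi)^2, and phi \<le> phi^3 turns it into 3^(2 phi^3).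
  The exponent 40 remains after all constants are absorbed into powers of n *
  \<open>lifetime G\<close>, which is at least 2 once there is a time-edge. Without time-edges
  \<open>lifetime G\<close> is unspecified; the answer still has to be right there, but no time
  bound is stated.\<close>

lemma pcas_append: "pcas u (p @ q) w \<longleftrightarrow> (\<exists>v. pcas u p v \<and> pcas v q w)"
  by (induction p arbitrary: u) auto

lemma pcas_upt: "a \<le> c \<Longrightarrow> pcas (g a) (map (\<lambda>i. (g i, g (Suc i))) [a..<c]) (g c)"
proof (induction c)
  case (Suc c)
  then show ?case
    by (cases "a = Suc c") (auto simp: pcas_append)
qed simp

lemma pcas_downt: "a \<le> c \<Longrightarrow> pcas (h c) (map (\<lambda>i. (h (Suc i), h i)) (rev [a..<c])) (h a)"
proof (induction c)
  case (Suc c)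
  then show ?case
    by (cases "a = Suc c") auto
qed simp

lemma pcas_imp_tl_verts: "pcas u p v \<Longrightarrow> tl (pawalk_verts u p) = map snd p"
proof (induction p arbitrary: u)
  case (Cons e p)
  then show ?case by (cases p) auto
qed simp

text \<open>The tail of the vertex list of a walk is the list of the heads of its arcs, so the
  simplicity condition on cycles becomes distinctness of \<open>map snd p\<close>.\<close>

lemma cycle_with_proj_iff:
  "pre_digraph.cycle (with_proj S) p \<longleftrightarrow>
    (\<exists>u. u \<in> pverts S \<and> set p \<subseteq> parcs S \<and> pcas u p u \<and> distinct (map snd p) \<and> p \<noteq> [])"
  unfolding pre_digraph.cycle_def pre_digraph.awalk_def
  by (auto simp: cas_with_proj_eq awalk_verts_with_proj_eq pcas_imp_tl_verts)

text \<open>Where the paths differ they would close up to a cycle. The level \<open>\<tau>\<close>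
  makes the index of a node along either path equal to its level, so no path revisits a node and a
  node common to both occurs at the same index in both.\<close>

lemma directed_tree_unique_path:
  fixes g h :: "nat \<Rightarrow> 'i"
  assumes tree: "directed_tree T"
    and level: "\<And>i j. (i, j) \<in> parcs T \<Longrightarrow> \<tau> j = Suc (\<tau> i)"
    and ends: "g a0 = h a0" "g c0 = h c0"
    and start: "\<tau> (g a0) = a0"
    and g: "\<And>t. a0 \<le> t \<Longrightarrow> t < c0 \<Longrightarrow> (g t, g (Suc t)) \<in> parcs T"
    and h: "\<And>t. a0 \<le> t \<Longrightarrow> t < c0 \<Longrightarrow> (h t, h (Suc t)) \<in> parcs T"
    and t: "a0 \<le> t" "t \<le> c0"
  shows "g t = h t"
proof (rule ccontr)
  assume ne: "g t \<noteq> h t"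
  have lg: "\<tau> (g s) = s" if "a0 \<le> s" "s \<le> c0" for s
    using that
  proof (induction s rule: dec_induct)
    case base then show ?case by (simp add: start)
  next
    case (step n) then show ?case using level[OF g[of n]] by auto
  qed
  have lh: "\<tau> (h s) = s" if "a0 \<le> s" "s \<le> c0" for s
    using that
  proof (induction s rule: dec_induct)
    case base then show ?case using start ends by simp
  next
    case (step n) then show ?case using level[OF h[of n]] by auto
  qed
  define a where "a = (GREATEST i. i \<le> t \<and> g i = h i)"
  define c where "c = (LEAST i. t \<le> i \<and> g i = h i)"
  have a: "a \<le> t \<and> g a = h a"
    unfolding a_def by (rule GreatestI_nat[where k = a0 and b = t]) (use t ends in auto)
  have a_max: "i \<le> a" if "i \<le> t" "g i = h i" for i
    unfolding a_def by (rule Greatest_le_nat[where b = t]) (use that in auto)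
  have c: "t \<le> c \<and> g c = h c"
    unfolding c_def by (rule LeastI[where k = c0]) (use t ends in auto)
  have c_min: "c \<le> i" if "t \<le> i" "g i = h i" for i
    unfolding c_def by (rule Least_le) (use that in auto)
  have rng: "a0 \<le> a" "c \<le> c0" using a_max[of a0] c_min[of c0] t ends by auto
  have ac: "a < t" "t < c" using a c ne by (auto simp: le_less)
  have diff: "g i \<noteq> h i" if "a < i" "i < c" for i
    using a_max[of i] c_min[of i] that by (cases "i \<le> t") auto
  \<comment> \<open>Between \<open>a\<close> and \<open>c\<close>, the nearest agreements around
    \<open>t\<close>, go up along \<open>g\<close> and return along \<open>h\<close>. The arc heads
    are \<open>g (a+1), ..., g c, h (c-1), ..., h a\<close>, each node once; as
    \<open>a < t < c\<close>, there are at least four of them.\<close>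
  define p where "p = map (\<lambda>i. (g i, g (Suc i))) [a..<c] @ map (\<lambda>i. (h (Suc i), h i)) (rev [a..<c])"
  let ?S = "mk_symmetric (with_proj T)"
  have wf: "pair_wf_digraph T"
    using tree by (auto simp: directed_tree_def pair_fin_digraph_def)
  have sym: "(i, j) \<in> parcs ?S \<and> (j, i) \<in> parcs ?S" if "(i, j) \<in> parcs T" for i j
    unfolding parcs_mk_symmetric using that by (auto intro!: bexI[of _ "(i, j)"])
  have "set p \<subseteq> parcs ?S"
    using sym[OF g] sym[OF h] rng unfolding p_def by auto
  moreover have "g a \<in> pverts ?S"
    using pair_wf_digraph.in_arcsD1[OF wf g[of a]] rng ac by simp
  moreover have "pcas (g a) p (g a)"
    unfolding p_def pcas_append using pcas_upt[of a c g] pcas_downt[of a c h] ac a c by auto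
  moreover have "distinct (map snd p)"
  proof -
    have "inj_on (\<lambda>i. g (Suc i)) {a..<c}"
      using lg rng by (intro inj_onI) (metis Suc_inject Suc_leI atLeastLessThan_iff le_SucI le_trans)
    moreover have "inj_on h {a..<c}"
      using lh rng by (intro inj_onI) (metis atLeastLessThan_iff less_imp_le le_trans)
    moreover have "g (Suc i) \<noteq> h j" if "i \<in> {a..<c}" "j \<in> {a..<c}" for i j
    proof
      assume eq: "g (Suc i) = h j"
      have "\<tau> (g (Suc i)) = Suc i" using that rng by (intro lg) auto
      moreover have "\<tau> (h j) = j" using that rng by (intro lh) auto
      ultimately show False using eq diff[of j] that by auto
    qed
    ultimately show ?thesis
      unfolding p_def by (auto simp: distinct_map comp_def)
  qed
  moreover have "p \<noteq> []" "3 \<le> length p" using ac unfolding p_def by auto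
  ultimately have "pre_digraph.cycle (with_proj ?S) p \<and> 3 \<le> length p"
    unfolding cycle_with_proj_iff by blast
  then show False using tree unfolding directed_tree_def by blast
qed

section \<open>Existence of TIM decompositions: the directed path\<close>

lemma pcas_nth:
  "pcas u p v \<Longrightarrow> i < length p \<Longrightarrow> fst (p ! i) = (if i = 0 then u else snd (p ! (i - 1)))"
proof (induction p arbitrary: u i)
  case (Cons e p)
  then show ?case by (cases i) (auto split: if_splits)
qed simp

lemma pcas_last: "pcas u p v \<Longrightarrow> p \<noteq> [] \<Longrightarrow> snd (p ! (length p - 1)) = v"
proof (induction p arbitrary: u)
  case (Cons e p)
  then show ?case by (cases p) auto
qed simp

definition path_digraph :: "nat \<Rightarrow> nat pair_pre_digraph" where
  "path_digraph L = \<lparr>pverts = {1..L}, parcs = {(i, j). i \<in> {1..L} \<and> j \<in> {1..L} \<and> j = i + 1}\<rparr>"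

text \<open>In a cycle of length at least 3 the largest vertex would have two different cyclic
  neighbours, but every vertex has only one smaller neighbour in the symmetric closure of a
  path.\<close>

lemma directed_tree_path_digraph:
  assumes "0 < L"
  shows "directed_tree (path_digraph L)"
proof -
  let ?T = "path_digraph L"
  let ?S = "mk_symmetric (with_proj ?T)"
  have arcS: "(i, j) \<in> parcs ?S \<longleftrightarrow> i \<in> {1..L} \<and> j \<in> {1..L} \<and> (j = i + 1 \<or> i = j + 1)" for i j
    by (auto simp: parcs_mk_symmetric path_digraph_def)
  have "parcs ?T \<subseteq> {1..L} \<times> {1..L}" by (auto simp: path_digraph_def)
  then have fin: "pair_fin_digraph ?T"
    by unfold_locales (auto simp: path_digraph_def intro: finite_subset)
  have wfS: "pair_wf_digraph ?S"
    using fin by (simp add: pair_fin_digraph_def wf_digraph.wellformed_mk_symmetric wf_digraph_wp_iff)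
  interpret S: pair_wf_digraph ?S by (rule wfS)
  have reach: "1 \<rightarrow>\<^sup>*\<^bsub>with_proj ?S\<^esub> v \<and> v \<rightarrow>\<^sup>*\<^bsub>with_proj ?S\<^esub> 1" if "v \<in> {1..L}" for v
  proof -
    have "1 \<le> v" "v \<le> L" using that by auto
    then show ?thesis
    proof (induction v rule: dec_induct)
      case base
      have "1 \<in> pverts ?S" using assms by (simp add: path_digraph_def)
      then show ?case by simp
    next
      case (step n)
      then have adj: "(n, Suc n) \<in> parcs ?S" "(Suc n, n) \<in> parcs ?S" by (auto simp: arcS)
      have "1 \<rightarrow>\<^sup>*\<^bsub>with_proj ?S\<^esub> n" "n \<rightarrow>\<^sup>*\<^bsub>with_proj ?S\<^esub> 1"
        using step by auto
      from S.reachable_adj_trans[OF this(1) adj(1)] S.adj_reachable_trans[OF adj(2) this(2)]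
      show ?case by (rule conjI)
    qed
  qed
  have conn: "Digraph_Component.connected (with_proj ?T)"
  proof -
    have V: "pverts ?S = {1..L}" by (simp add: path_digraph_def)
    show ?thesis
      unfolding connected_def strongly_connected_def with_proj_simps V
    proof (intro conjI ballI)
      show "{1..L} \<noteq> {}" using assms by simp
      fix u v assume "u \<in> {1..L}" "v \<in> {1..L}"
      from S.reachable_trans[OF conjunct2[OF reach[OF this(1)]] conjunct1[OF reach[OF this(2)]]]
      show "u \<rightarrow>\<^sup>*\<^bsub>with_proj ?S\<^esub> v" .
    qed
  qed
  have short: "\<not> 3 \<le> length p" if "pre_digraph.cycle (with_proj ?S) p" for p
  proof
    assume len: "3 \<le> length p"
    from that obtain u where p: "set p \<subseteq> parcs ?S" "pcas u p u" "distinct (map snd p)" "p \<noteq> []"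
      unfolding cycle_with_proj_iff by (elim exE conjE)
    define f where "f i = snd (p ! i)" for i
    let ?l = "length p"
    have inj: "i = j" if "f i = f j" "i < ?l" "j < ?l" for i j
      using that p(3) by (auto simp: f_def distinct_map distinct_conv_nth inj_on_def)
    have adj: "f i = f (if i = 0 then ?l - 1 else i - 1) + 1 \<or> f (if i = 0 then ?l - 1 else i - 1) = f i + 1"
      if "i < ?l" for i
    proof -
      have "(fst (p ! i), snd (p ! i)) \<in> parcs ?S" using that p(1) by auto
      then show ?thesis using pcas_nth[OF p(2) that] pcas_last[OF p(2,4)]
        unfolding arcS f_def by (auto split: if_splits)
    qed
    have fin: "finite (f ` {..<?l})" by simp
    have "f ` {..<?l} \<noteq> {}" using p(4) by (simp add: lessThan_empty_iff)
    from Max_in[OF fin this] obtain i where i: "i < ?l" "f i = Max (f ` {..<?l})"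
      by auto
    then have le: "f j \<le> f i" if "j < ?l" for j using that fin by simp
    \<comment> \<open>The cyclic predecessor and successor of a position \<open>i\<close> where the
      maximum is attained; both must carry the value \<open>f i - 1\<close>, so by injectivity they
      coincide.\<close>
    let ?j = "if i = 0 then ?l - 1 else i - 1" and ?k = "if i = ?l - 1 then 0 else i + 1"
    have jk: "?j < ?l" "?k < ?l" using i(1) by auto
    have "f i = f ?j + 1" using adj[OF i(1)] le[OF jk(1)] by linarith
    moreover have "(if ?k = 0 then ?l - 1 else ?k - 1) = i" using i(1) by auto
    then have "f i = f ?k + 1" using adj[OF jk(2)] le[OF jk(2)] by presburger
    ultimately have "f ?j = f ?k" by simp
    from inj[OF this jk] have "?j = ?k" .
    then show False using len i(1) by (auto split: if_splits)
  qed
  show ?thesis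
    unfolding directed_tree_def
  proof (intro conjI fin conn notI)
    show "asym (parcs ?T)" by (rule asymI) (simp add: path_digraph_def)
    assume "\<exists>c. pre_digraph.cycle (with_proj ?S) c \<and> 3 \<le> length c"
    then obtain c where c: "pre_digraph.cycle (with_proj ?S) c" "3 \<le> length c" by (elim exE conjE)
    from short[OF c(1)] c(2) show False by (rule notE)
  qed
qed

lemma finite_time_edges:
  assumes "is_temporal_graph G"
  shows "finite (time_edges G)"
proof -
  have "edges G \<subseteq> Pow (vertices G)" using assms by (auto simp: is_temporal_graph_def)
  then have "finite (edges G)"
    using assms by (auto simp: is_temporal_graph_def intro: finite_subset)
  moreover have "time_edges G = Sigma (edges G) (labels G)" by (auto simp: time_edges_def)
  ultimately show ?thesis using assms by (auto simp: is_temporal_graph_def)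
qed

lemma time_edge_le_lifetime:
  assumes "is_temporal_graph G" "(e, t) \<in> time_edges G"
  shows "t \<in> {1..lifetime G}" "e \<subseteq> vertices G" "card e = 2"
proof -
  have "t \<le> lifetime G"
    unfolding lifetime_def using finite_time_edges[OF assms(1)] assms(2) by (intro Max_ge) force+
  moreover have "e \<in> edges G" "t \<in> labels G e" using assms(2) by (auto simp: time_edges_def)
  then have "0 \<notin> labels G e" "e \<subseteq> vertices G" "card e = 2"
    using assms(1) unfolding is_temporal_graph_def by auto
  moreover from this have "t \<noteq> 0" using \<open>t \<in> labels G e\<close> by metis
  ultimately show "t \<in> {1..lifetime G}" "e \<subseteq> vertices G" "card e = 2" by auto
qed

text \<open>A time-edge supplies a vertex, without which consecutive bags would not meet, and a
  positive lifetime, without which the path would have no node.\<close>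

lemma TIM_decomposition_path_digraph:
  assumes G: "is_temporal_graph G" and ne: "time_edges G \<noteq> {}"
  shows "TIM_decomposition G (path_digraph (lifetime G)) (\<lambda>_. vertices G) id"
proof -
  obtain e t where et: "(e, t) \<in> time_edges G" using ne by auto
  have "vertices G \<noteq> {}" "0 < lifetime G"
    using time_edge_le_lifetime[OF G et] by auto
  then have tree: "directed_tree (path_digraph (lifetime G))" and
    arc: "(i, j) \<in> parcs (path_digraph (lifetime G)) \<longleftrightarrow>
      i \<in> {1..lifetime G} \<and> j \<in> {1..lifetime G} \<and> vertices G \<inter> vertices G \<noteq> {} \<and> id j = id i + 1" for i j
    by (auto simp: directed_tree_path_digraph) (auto simp: path_digraph_def)
  have V: "pverts (path_digraph (lifetime G)) = {1..lifetime G}" by (simp add: path_digraph_def)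
  show ?thesis
    unfolding TIM_decomposition_def V
  proof (intro conjI tree ballI)
    fix et assume "et \<in> time_edges G"
    then show "case et of (e, t) \<Rightarrow>
        \<exists>!i. i \<in> {1..lifetime G} \<and> e \<subseteq> vertices G \<and> id i = t"
      using time_edge_le_lifetime[OF G] by (cases et) auto
  qed (use arc in auto)
qed

text \<open>The \<open>LEAST\<close> in \<open>TIM_width\<close> ranges over a nonempty set of
  widths, thanks to the path decomposition. The counting argument is carried out in the optimal
  decomposition obtained here.\<close>

lemma TIM_width_attained:
  assumes "is_temporal_graph G" "time_edges G \<noteq> {}"
  obtains T :: "nat pair_pre_digraph" and B \<tau>
  where "TIM_decomposition G T B \<tau>" "TIM_decomposition_width T B = TIM_width G"
proof -
  define P where "P w \<longleftrightarrow> (\<exists>(T :: nat pair_pre_digraph) B \<tau>.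
    TIM_decomposition G T B \<tau> \<and> TIM_decomposition_width T B = w)" for w
  have "P (TIM_decomposition_width (path_digraph (lifetime G)) (\<lambda>_. vertices G))"
    unfolding P_def using TIM_decomposition_path_digraph[OF assms] by (intro exI conjI) auto
  then have "P (Least P)" by (rule LeastI)
  then show thesis
    using that unfolding P_def TIM_width_def by (elim exE conjE)
qed

section \<open>Reasoning about programs\<close>

text \<open>A weakest precondition for total correctness whose postcondition also receives the
  number of steps. With the equations below, simplification executes straight-line code and adds up
  its exact cost.\<close>

definition run :: "com \<Rightarrow> state \<Rightarrow> (nat \<Rightarrow> state \<Rightarrow> bool) \<Rightarrow> bool" where
  "run c s Q \<longleftrightarrow> (\<exists>t s'. exec c s t s' \<and> Q t s')"

inductive_cases exec_SkipE: "exec Skip s t s'"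
inductive_cases exec_AssignE: "exec (Assign x a b) s t s'"
inductive_cases exec_SeqE: "exec (Seq c1 c2) s t s'"
inductive_cases exec_CondE: "exec (Cond b c1 c2) s t s'"

abbreviation update_cell :: "state \<Rightarrow> string \<Rightarrow> nat \<Rightarrow> nat \<Rightarrow> state" where
  "update_cell s x i v \<equiv> s(x := (s x)(i := v))"

lemma run_Skip [simp]: "run Skip s Q \<longleftrightarrow> Q 1 s"
  unfolding run_def by (rule iffI, elim exE conjE exec_SkipE, simp, intro exI conjI, rule exec.Skip)

lemma run_Assign [simp]:
  "run (Assign x a b) s Q \<longleftrightarrow> Q (1 + acost a + acost b) (update_cell s x (aval a s) (aval b s))"
  unfolding run_def by (rule iffI, elim exE conjE exec_AssignE, simp, intro exI conjI, rule exec.Assign)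

lemma run_Seq [simp]:
  "run (Seq c1 c2) s Q \<longleftrightarrow> run c1 s (\<lambda>t1 s1. run c2 s1 (\<lambda>t2 s2. Q (t1 + t2) s2))"
proof
  assume "run (Seq c1 c2) s Q"
  then show "run c1 s (\<lambda>t1 s1. run c2 s1 (\<lambda>t2 s2. Q (t1 + t2) s2))"
    unfolding run_def by (elim exE conjE exec_SeqE) blast
next
  assume "run c1 s (\<lambda>t1 s1. run c2 s1 (\<lambda>t2 s2. Q (t1 + t2) s2))"
  then show "run (Seq c1 c2) s Q"
    unfolding run_def by (elim exE conjE) (intro exI conjI, rule exec.Seq)
qed

lemma run_Cond [simp]:
  "run (Cond b c1 c2) s Q \<longleftrightarrow>
    (if bval b s then run c1 s (\<lambda>t. Q (1 + bcost b + t)) else run c2 s (\<lambda>t. Q (1 + bcost b + t)))"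
proof
  assume "run (Cond b c1 c2) s Q"
  then show "if bval b s then run c1 s (\<lambda>t. Q (1 + bcost b + t)) else run c2 s (\<lambda>t. Q (1 + bcost b + t))"
    unfolding run_def by (elim exE conjE exec_CondE) (simp, blast)+
next
  assume *: "if bval b s then run c1 s (\<lambda>t. Q (1 + bcost b + t)) else run c2 s (\<lambda>t. Q (1 + bcost b + t))"
  show "run (Cond b c1 c2) s Q"
  proof (cases "bval b s")
    case True
    with * obtain t s' where "exec c1 s t s'" "Q (1 + bcost b + t) s'" by (auto simp: run_def)
    with exec.CondTrue[OF True this(1)] show ?thesis unfolding run_def by blast
  next
    case False
    with * obtain t s' where "exec c2 s t s'" "Q (1 + bcost b + t) s'" by (auto simp: run_def)
    with exec.CondFalse[OF False this(1)] show ?thesis unfolding run_def by blast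
  qed
qed

lemma run_mono: "run c s Q \<Longrightarrow> (\<And>t s'. Q t s' \<Longrightarrow> Q' t s') \<Longrightarrow> run c s Q'"
  unfolding run_def by blast

text \<open>The measure \<open>m\<close> bounds the number of iterations and \<open>K\<close> the
  cost of each execution of the body; the \<open>Suc\<close> pays for the final, failing
  test.\<close>

lemma run_While:
  assumes "I s"
    and step: "\<And>s. I s \<Longrightarrow> bval b s \<Longrightarrow> run c s (\<lambda>t s'. t \<le> K \<and> I s' \<and> m s' < m s)"
  shows "run (While b c) s (\<lambda>t s'. t \<le> Suc (m s) * (1 + bcost b + K) \<and> I s' \<and> \<not> bval b s')"
  using assms(1)
proof (induction "m s" arbitrary: s rule: less_induct)
  case less
  show ?case
  proof (cases "bval b s")
    case False
    have "1 + bcost b \<le> Suc (m s) * (1 + bcost b + K)" by simp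
    with exec.WhileFalse[OF False, of c] less.prems False show ?thesis unfolding run_def by blast
  next
    case True
    obtain t1 s1 where 1: "exec c s t1 s1" "t1 \<le> K" "I s1" "m s1 < m s"
      using step[OF less.prems True] unfolding run_def by blast
    obtain t2 s2 where 2: "exec (While b c) s1 t2 s2" "t2 \<le> Suc (m s1) * (1 + bcost b + K)"
        "I s2" "\<not> bval b s2"
      using less.hyps[OF 1(4,3)] unfolding run_def by blast
    have "1 + bcost b + t1 + t2 \<le> (1 + bcost b + K) + Suc (m s1) * (1 + bcost b + K)"
      using 1(2) 2(2) by linarith
    also have "\<dots> = Suc (Suc (m s1)) * (1 + bcost b + K)" by simp
    also have "\<dots> \<le> Suc (m s) * (1 + bcost b + K)" using 1(4) by (intro mult_le_mono1) simp
    finally show ?thesis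
      using exec.WhileTrue[OF True 1(1) 2(1)] 2(3,4) unfolding run_def by blast
  qed
qed

abbreviation Var :: "string \<Rightarrow> aexp" where
  "Var x \<equiv> Cell x (Num 0)"

abbreviation Set :: "string \<Rightarrow> aexp \<Rightarrow> com" where
  "Set x a \<equiv> Assign x (Num 0) a"

definition For :: "string \<Rightarrow> aexp \<Rightarrow> com \<Rightarrow> com" where
  "For i a c = Seq (Set i (Num 0)) (While (Less (Var i) a) (Seq c (Set i (Plus (Var i) (Num 1)))))"

text \<open>The bound \<open>a\<close> is evaluated anew before each iteration, so the invariant has
  to fix its value \<open>N\<close>. The invariant for \<open>Suc k\<close> is demanded after the
  increment of the loop variable, which the body itself has to leave at \<open>k\<close>. The
  constants are 3 for the initialisation and 10 = 4 + 6 for the test (apart from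
  \<open>acost a\<close>) and the increment.\<close>

lemma run_For:
  assumes init: "I 0 (update_cell s i 0 0)"
    and bound: "\<And>k s. I k s \<Longrightarrow> s i 0 = k \<Longrightarrow> aval a s = N"
    and step: "\<And>k s. I k s \<Longrightarrow> s i 0 = k \<Longrightarrow> k < N \<Longrightarrow>
      run c s (\<lambda>t s'. t \<le> K \<and> s' i 0 = k \<and> I (Suc k) (update_cell s' i 0 (Suc k)))"
    and post: "\<And>t s'. t \<le> 3 + (N + 1) * (10 + acost a + K) \<Longrightarrow> I N s' \<Longrightarrow> s' i 0 = N \<Longrightarrow> Q t s'"
  shows "run (For i a c) s Q"
proof -
  let ?J = "\<lambda>s. I (s i 0) s \<and> s i 0 \<le> N"
  let ?c = "Seq c (Set i (Plus (Var i) (Num 1)))"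
  let ?b = "Less (Var i) a"
  let ?s = "update_cell s i 0 0"
  have "run (While ?b ?c) ?s (\<lambda>t s'. t \<le> Suc (N - ?s i 0) * (1 + bcost ?b + (K + 6)) \<and> ?J s' \<and> \<not> bval ?b s')"
  proof (rule run_While)
    show "?J ?s" using init by simp
    fix s assume J: "?J s" and b: "bval ?b s"
    have "s i 0 < N" using J b bound[of "s i 0" s] by simp
    from step[OF conjunct1[OF J] refl this]
    show "run ?c s (\<lambda>t s'. t \<le> K + 6 \<and> ?J s' \<and> N - s' i 0 < N - s i 0)"
      unfolding run_Seq by (rule run_mono) (use \<open>s i 0 < N\<close> in auto)
  qed
  then show ?thesis
    unfolding For_def run_Seq run_Assign
  proof (simp, elim run_mono, goal_cases)
    case (1 t s')
    then have "s' i 0 = N" using bound[of "s' i 0" s'] by auto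
    then show ?case using 1 by (intro post) (auto simp: algebra_simps)
  qed
qed

section \<open>The search space\<close>

type_synonym arc = "nat \<times> nat \<times> nat"
type_synonym conf = "nat \<times> nat \<times> nat set"

text \<open>
  A configuration \<open>(x, s, V)\<close> stands for a path that has visited \<open>V\<close>, is at \<open>x\<close>, and may use arcs
  with times at least \<open>s\<close>.  \<open>reach\<close> processes the arcs of one time step in the order of the list, so
  it may also follow some walks whose times are not strictly increasing; they stay within a bag.
\<close>

definition relax :: "nat \<Rightarrow> nat \<Rightarrow> arc \<Rightarrow> nat set \<Rightarrow> nat set" where
  "relax s t = (\<lambda>(u, v, t') R. if s \<le> t \<and> t' = t \<and> u \<in> R then insert v R else R)"

primrec reach :: "arc list \<Rightarrow> nat \<Rightarrow> nat \<Rightarrow> nat \<Rightarrow> nat set" where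
  "reach A x s 0 = {x}"
| "reach A x s (Suc k) = fold (relax s k) A (reach A x s k)"

text \<open>Stage \<open>k\<close> of \<open>reach\<close> has processed the times below
  \<open>k\<close>, so \<open>Suc L\<close> stages are what it takes to include time
  \<open>L\<close>.\<close>

definition good :: "nat \<Rightarrow> arc list \<Rightarrow> nat \<Rightarrow> conf \<Rightarrow> bool" where
  "good n A L = (\<lambda>(x, s, V). {..<n} - V \<subseteq> reach A x s (Suc L))"

definition succs :: "arc list \<Rightarrow> conf \<Rightarrow> conf set" where
  "succs A = (\<lambda>(x, s, V). {(y, Suc t, insert y V) |y t. (x, y, t) \<in> set A \<and> s \<le> t \<and> y \<notin> V})"

text \<open>Only good configurations are expanded, but their successors enter untested. This mirrors
  the queue of the program, in which a configuration is stored when found and tested when its turn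
  comes. The root stands at a virtual source \<open>n\<close>.\<close>

inductive_set confs :: "nat \<Rightarrow> arc list \<Rightarrow> nat \<Rightarrow> conf set" for n A L where
  root: "(n, 0, {}) \<in> confs n A L"
| step: "c \<in> confs n A L \<Longrightarrow> good n A L c \<Longrightarrow> c' \<in> succs A c \<Longrightarrow> c' \<in> confs n A L"

section \<open>Lower and upper bounds for one pass over the arcs\<close>

lemma relax_Pair:
  "relax s t (u, v, t') R = (if s \<le> t \<and> t' = t \<and> u \<in> R then insert v R else R)"
  by (simp add: relax_def)

lemma relax_superset: "R \<subseteq> relax s t a R"
  by (auto simp: relax_def split: prod.splits)

lemma fold_relax_superset: "R \<subseteq> fold (relax s t) A R"
proof (induction A arbitrary: R)
  case (Cons a A)
  then show ?case using relax_superset[of R s t a] by (simp, blast)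
qed simp

lemma fold_relax_arc:
  assumes "(u, v, t) \<in> set A" "u \<in> R" "s \<le> t"
  shows "v \<in> fold (relax s t) A R"
  using assms
proof (induction A arbitrary: R)
  case (Cons a A)
  show ?case
  proof (cases "a = (u, v, t)")
    case True
    then have "v \<in> relax s t a R" using Cons.prems by (simp add: relax_def)
    then show ?thesis using fold_relax_superset by fastforce
  next
    case False
    then show ?thesis
      using Cons relax_superset[of R s t a] by auto
  qed
qed simp

text \<open>The counterpart of \<open>fold_relax_arc\<close>: a property preserved by all usable
  arcs of time \<open>t\<close> survives the whole pass, whatever the order of the arcs.\<close>

lemma fold_relax_induct:
  assumes "\<And>x. x \<in> R \<Longrightarrow> P x"
    and "\<And>u v. (u, v, t) \<in> set A \<Longrightarrow> s \<le> t \<Longrightarrow> P u \<Longrightarrow> P v"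
    and "x \<in> fold (relax s t) A R"
  shows "P x"
  using assms
proof (induction A arbitrary: R)
  case (Cons a A)
  show ?case
  proof (rule Cons.IH[of "relax s t a R"])
    fix y assume "y \<in> relax s t a R"
    then show "P y"
      using Cons.prems(1,2) by (auto simp: relax_def split: prod.splits if_splits)
  qed (use Cons.prems in auto)
qed simp

lemma reach_mono: "k \<le> k' \<Longrightarrow> reach A x s k \<subseteq> reach A x s k'"
proof (induction k' rule: dec_induct)
  case (step k')
  then show ?case using fold_relax_superset[of "reach A x s k'" s k' A] by auto
qed simp

text \<open>Time-edges appear in both orientations, next to one arc of time 0 from the source to
  each vertex. \<open>L\<close> is merely an upper bound on the times, so that graphs without
  time-edges, whose \<open>lifetime\<close> is unspecified, are covered as well.\<close>

locale temporal_instance =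
  fixes G :: "nat temporal_graph" and n :: nat and A :: "arc list" and L :: nat
  assumes temporal_graph: "is_temporal_graph G"
    and vertices: "vertices G = {..<n}"
    and arcs: "set A = {(n, x, 0) |x. x < n} \<union> {(a, b, t). ({a, b}, t) \<in> time_edges G}"
    and arc_time_le: "(a, b, t) \<in> set A \<Longrightarrow> t \<le> L"
begin

lemma time_edgeD:
  assumes "({a, b}, t) \<in> time_edges G"
  shows "a < n" "b < n" "a \<noteq> b" "1 \<le> t" "t \<le> lifetime G"
  using time_edge_le_lifetime[OF temporal_graph assms] by (auto simp: vertices)

lemma arc_source: "(n, y, t) \<in> set A \<longleftrightarrow> t = 0 \<and> y < n"
  unfolding arcs using time_edgeD by fastforce

lemma arc_vertex: "x < n \<Longrightarrow> (x, y, t) \<in> set A \<longleftrightarrow> ({x, y}, t) \<in> time_edges G"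
  unfolding arcs by auto

lemma arc_endpoints: "(x, y, t) \<in> set A \<Longrightarrow> x \<le> n \<and> y < n"
  unfolding arcs using time_edgeD(1,2) by fastforce

text \<open>No arc enters the source, so the root is the only configuration located there; any other
  one has just used an arc of some time \<open>t\<close> and carries
  \<open>s = Suc t\<close>.\<close>

lemma confs_bounds:
  "(x, s, V) \<in> confs n A L \<Longrightarrow>
    (x, s, V) = (n, 0, {}) \<or> x < n \<and> x \<in> V \<and> V \<subseteq> {..<n} \<and> 1 \<le> s \<and> s \<le> Suc L"
proof (induction "(x, s, V)" arbitrary: x s V rule: confs.induct)
  case (step c)
  obtain x' s' V' where c: "c = (x', s', V')" by (cases c)
  show ?case
    using step(2)[OF c] step(4) arc_endpoints arc_time_le unfolding c succs_def by fastforce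
qed simp

lemma finite_confs: "finite (confs n A L)"
proof (rule finite_subset)
  show "confs n A L \<subseteq> {..n} \<times> {..Suc L} \<times> Pow {..<n}"
    using confs_bounds by fastforce
qed simp

text \<open>The entry \<open>s\<close> exceeds all times used so far, so an arc of time at least
  \<open>s\<close> extends the path strictly. A step out of the source contributes no time-edge; it
  starts a one-vertex path.\<close>

lemma confs_temporal_path:
  "(x, s, V) \<in> confs n A L \<Longrightarrow> x < n \<Longrightarrow>
    \<exists>vs p. temporal_path G vs p \<and> last vs = x \<and> set vs = V \<and> (\<forall>t\<in>snd ` set p. t < s)"
proof (induction "(x, s, V)" arbitrary: x s V rule: confs.induct)
  case root then show ?case by simp
next
  case (step c)
  obtain x' s' V' where c: "c = (x', s', V')" by (cases c)
  obtain t where t: "(x', x, t) \<in> set A" "s' \<le> t" "x \<notin> V'" "s = Suc t" "V = insert x V'"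
    using step(4) unfolding c succs_def by auto
  show ?case
  proof (cases "x' < n")
    case True
    obtain vs p where p: "temporal_path G vs p" "last vs = x'" "set vs = V'" "\<forall>t\<in>snd ` set p. t < s'"
      using step(2)[OF c True] by blast
    have len: "length vs = Suc (length p)" using p(1) by (simp add: temporal_path_def)
    then have "vs ! length p = x'" using p(2) by (metis diff_Suc_1 last_conv_nth length_0_conv nat.simps(3))
    moreover have "({x', x}, t) \<in> time_edges G" using t(1) arc_vertex[OF True] by simp
    ultimately have "temporal_path G (vs @ [x]) (p @ [({x', x}, t)])"
      using p t step.prems len unfolding temporal_path_def
      by (fastforce simp: nth_append vertices sorted_wrt_append less_Suc_eq)
    moreover have "\<forall>t'\<in>snd ` set (p @ [({x', x}, t)]). t' < s" using p(4) t by auto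
    ultimately show ?thesis using p(3) t(5) by (intro exI[of _ "vs @ [x]"] exI conjI) auto
  next
    case False
    then have "V' = {}" using confs_bounds[of x' s' V'] step(1) c by auto
    then show ?thesis
      using t step.prems
      by (intro exI[of _ "[x]"] exI[of _ "[]"]) (auto simp: temporal_path_def vertices)
  qed
qed

text \<open>
  The virtual source \<open>n\<close>, left at time 0, turns a path into a walk all of whose vertices are
  entered by an arc.
\<close>

lemma hamiltonian_path_confs:
  assumes "has_temporal_hamiltonian_path G"
  shows "\<exists>x s. x < n \<and> (x, s, {..<n}) \<in> confs n A L"
proof -
  obtain vs p where p: "temporal_path G vs p" and ham: "set vs = {..<n}"
    using assms by (auto simp: has_temporal_hamiltonian_path_def vertices)
  have len: "length vs = Suc (length p)" and dist: "distinct vs" using p by (auto simp: temporal_path_def)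
  \<comment> \<open>Arc \<open>i\<close> leads from \<open>w ! i\<close> to \<open>w ! Suc i\<close>
    at time \<open>tm ! i\<close>, and \<open>S i\<close> is the time entry of the configuration
    located at \<open>w ! i\<close>.\<close>
  define w where "w = n # vs"
  define tm where "tm = 0 # map snd p"
  define S where "S i = (case i of 0 \<Rightarrow> 0 | Suc j \<Rightarrow> Suc (tm ! j))" for i
  have te: "({vs ! i, vs ! Suc i}, snd (p ! i)) \<in> time_edges G" if "i < length p" for i
  proof -
    have "p ! i \<in> time_edges G" "fst (p ! i) = {vs ! i, vs ! Suc i}"
      using p that by (auto simp: temporal_path_def)
    then show ?thesis by (metis prod.collapse)
  qed
  have vs_lt: "vs ! i < n" if "i < length vs" for i using ham that nth_mem by fastforce
  have arc: "(w ! i, w ! Suc i, tm ! i) \<in> set A" if "i < length vs" for i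
  proof (cases i)
    case 0
    then show ?thesis using vs_lt[of 0] len by (simp add: w_def tm_def arc_source)
  next
    case (Suc j)
    then show ?thesis
      using te[of j] vs_lt[of j] arc_vertex that len by (simp add: w_def tm_def)
  qed
  have S_le: "S i \<le> tm ! i" if "i < length vs" for i
  proof (cases i)
    case (Suc j)
    show ?thesis
    proof (cases j)
      \<comment> \<open>The source arc has time 0 and leaves the entry 1, which the path can meet
        because its times are positive.\<close>
      case 0
      then show ?thesis using Suc te[of 0] time_edgeD(4) that len by (fastforce simp: S_def tm_def)
    next
      case (Suc k)
      have "sorted_wrt (<) (map snd p)" using p by (simp add: temporal_path_def)
      then have "snd (p ! k) < snd (p ! Suc k)"
        using \<open>i = Suc j\<close> Suc that len by (auto simp: sorted_wrt_iff_nth_less)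
      then show ?thesis using \<open>i = Suc j\<close> Suc that len by (simp add: S_def tm_def)
    qed
  qed (simp add: S_def)
  have S_Suc: "S (Suc i) = Suc (tm ! i)" for i by (simp add: S_def)
  have S_step: "S i \<le> S (Suc i)" if "i < length vs" for i
    using S_le[OF that] by (simp add: S_Suc)
  have S_mono: "S i \<le> S j" if "i \<le> j" "j \<le> length vs" for i j
    using that
  proof (induction j rule: dec_induct)
    case (step m) then show ?case using S_step[of m] by simp
  qed simp
  have reach: "w ! j \<in> reach A (w ! i) (S i) (S j)" if "i \<le> j" "j \<le> length vs" for i j
    using that
  proof (induction j rule: dec_induct)
    case base
    then show ?case using reach_mono[of 0 "S i"] by auto
  next
    case (step m)
    have m: "m < length vs" using step by simp
    have "w ! m \<in> reach A (w ! i) (S i) (tm ! m)"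
      using step reach_mono[OF S_le[OF m]] by auto
    moreover have "S i \<le> tm ! m" using S_mono[of i m] S_le[OF m] step m by simp
    ultimately show ?case using fold_relax_arc[OF arc[OF m]] by (simp add: S_Suc)
  qed
  have S_bound: "S j \<le> Suc L" if "j \<le> length vs" for j
    using arc_time_le[OF arc] that by (auto simp: S_def split: nat.splits)
  \<comment> \<open>A vertex not yet visited occurs later in \<open>vs\<close>, and the remainder of
    the path is itself a walk that reaches it.\<close>
  have good: "good n A L (w ! i, S i, set (take i vs))" if "i \<le> length vs" for i
    unfolding good_def
  proof (clarify)
    fix x assume "x < n" "x \<notin> set (take i vs)"
    then have "x \<in> set (drop i vs)" using ham append_take_drop_id[of i vs] by (metis Un_iff lessThan_iff set_append)
    then obtain k where k: "k < length vs - i" "x = vs ! (i + k)"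
      using that by (auto simp: in_set_conv_nth)
    then have "x \<in> reach A (w ! i) (S i) (S (Suc (i + k)))"
      using reach[of i "Suc (i + k)"] by (simp add: w_def)
    then show "x \<in> reach A (w ! i) (S i) (Suc L)"
      using subsetD[OF reach_mono[OF S_bound[of "Suc (i + k)"]]] k by (simp del: reach.simps)
  qed
  have "(w ! i, S i, set (take i vs)) \<in> confs n A L" if "i \<le> length vs" for i
    using that
  proof (induction i)
    case 0
    then show ?case by (simp add: w_def S_def confs.root)
  next
    case (Suc i)
    then have "vs ! i \<notin> set (take i vs)"
      using dist by (simp add: distinct_conv_nth in_set_conv_nth)
    then have "(w ! Suc i, S (Suc i), set (take (Suc i) vs)) \<in> succs A (w ! i, S i, set (take i vs))"
      using arc[of i] S_le[of i] Suc.prems by (auto simp: succs_def S_Suc w_def take_Suc_conv_app_nth)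
    then show ?case using Suc good[of i] by (blast intro: confs.step Suc_leD)
  qed
  from this[of "length vs"] have "(w ! length vs, S (length vs), {..<n}) \<in> confs n A L"
    by (simp add: ham)
  moreover have "w ! length vs < n" using vs_lt[of "length p"] len by (simp add: w_def)
  ultimately show ?thesis by blast
qed

lemma has_temporal_hamiltonian_path_iff:
  "has_temporal_hamiltonian_path G \<longleftrightarrow> (\<exists>x s. x < n \<and> (x, s, {..<n}) \<in> confs n A L)"
  using hamiltonian_path_confs confs_temporal_path
  unfolding has_temporal_hamiltonian_path_def vertices by blast

section \<open>Counting all configurations by the good ones\<close>

lemma finite_good_confs: "finite {c \<in> confs n A L. good n A L c}"
  using finite_confs by simp

text \<open>A parent and an arc determine the child by \<open>?f\<close>, and every configuration
  except the root has a good parent.\<close>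

lemma card_confs_le: "card (confs n A L) \<le> 1 + card {c \<in> confs n A L. good n A L c} * length A"
proof -
  let ?H = "{c \<in> confs n A L. good n A L c}"
  let ?f = "\<lambda>(c :: conf, (u, v, t)). (v, Suc t, insert v (snd (snd c)))"
  have "confs n A L \<subseteq> insert (n, 0, {}) (?f ` (?H \<times> set A))"
  proof
    fix c assume "c \<in> confs n A L"
    then show "c \<in> insert (n, 0, {}) (?f ` (?H \<times> set A))"
    proof cases
      case (step d)
      obtain x s V where d: "d = (x, s, V)" by (cases d)
      from step(3) obtain y t where "c = (y, Suc t, insert y V)" "(x, y, t) \<in> set A"
        unfolding d succs_def by auto
      then have "c = ?f (d, (x, y, t))" "(d, (x, y, t)) \<in> ?H \<times> set A" using step d by auto
      then show ?thesis by blast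
    qed simp
  qed
  then have "card (confs n A L) \<le> card (insert (n, 0, {}) (?f ` (?H \<times> set A)))"
    using finite_good_confs by (intro card_mono) auto
  also have "\<dots> \<le> 1 + card (?f ` (?H \<times> set A))"
    using card_insert_le_m1 by (simp add: card_insert_if finite_good_confs)
  also have "\<dots> \<le> 1 + card (?H \<times> set A)"
    using finite_good_confs by (intro add_left_mono card_image_le) simp
  also have "\<dots> \<le> 1 + card ?H * length A"
    by (simp add: card_cartesian_product card_length)
  finally show ?thesis .
qed

end

section \<open>Configurations and the bags of a TIM decomposition\<close>

locale TIM_instance = temporal_instance +
  fixes T :: "nat pair_pre_digraph" and B \<tau>
  assumes TIM: "TIM_decomposition G T B \<tau>"
    and nonempty: "time_edges G \<noteq> {}"
    and L: "L = lifetime G"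
begin

text \<open>Meaningful for \<open>v < n\<close> and \<open>1 \<le> t \<le> L\<close>, where the
  first condition on TIM decompositions yields exactly one such node.\<close>

definition bag :: "nat \<Rightarrow> nat \<Rightarrow> nat" where
  "bag v t = (THE i. i \<in> pverts T \<and> v \<in> B i \<and> \<tau> i = t)"

lemma ex1_bag: "v < n \<Longrightarrow> 1 \<le> t \<Longrightarrow> t \<le> L \<Longrightarrow> \<exists>!i. i \<in> pverts T \<and> v \<in> B i \<and> \<tau> i = t"
  using TIM unfolding TIM_decomposition_def vertices L by simp

lemma bag:
  assumes "v < n" "1 \<le> t" "t \<le> L"
  shows "bag v t \<in> pverts T" "v \<in> B (bag v t)" "\<tau> (bag v t) = t"
  using theI'[OF ex1_bag[OF assms]] unfolding bag_def by auto

lemma bag_eqI: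
  assumes "v < n" "1 \<le> t" "t \<le> L" "i \<in> pverts T" "v \<in> B i" "\<tau> i = t"
  shows "bag v t = i"
  using ex1_bag[OF assms(1-3)] bag[OF assms(1-3)] assms(4-6) by blast

lemma parcs: "parcs T = {(i, j). i \<in> pverts T \<and> j \<in> pverts T \<and> B i \<inter> B j \<noteq> {} \<and> \<tau> j = \<tau> i + 1}"
  using TIM unfolding TIM_decomposition_def by (elim conjE)

text \<open>Both bags contain \<open>v\<close> and their times are consecutive, which is all that an
  arc requires. Thus the bags of a vertex form a directed path in \<open>T\<close>.\<close>

lemma bag_arc: "v < n \<Longrightarrow> 1 \<le> t \<Longrightarrow> t < L \<Longrightarrow> (bag v t, bag v (Suc t)) \<in> parcs T"
  using bag[of v t] bag[of v "Suc t"] unfolding parcs by auto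

lemma bag_time_edge:
  assumes "({x, y}, t) \<in> time_edges G"
  shows "bag x t = bag y t"
proof -
  have xy: "x < n" "y < n" "1 \<le> t" "t \<le> L" using time_edgeD[OF assms] L by auto
  have "\<forall>(e, t)\<in>time_edges G. \<exists>!i. i \<in> pverts T \<and> e \<subseteq> B i \<and> \<tau> i = t"
    using TIM unfolding TIM_decomposition_def by (elim conjE)
  from bspec[OF this assms] obtain i where "i \<in> pverts T" "{x, y} \<subseteq> B i" "\<tau> i = t" by auto
  then show ?thesis using bag_eqI[OF xy(1,3,4)] bag_eqI[OF xy(2,3,4)] by simp
qed

text \<open>A directed path in \<open>T\<close>, parametrised by time: \<open>g t\<close> is its
  node at level \<open>t\<close>. Every arc raises \<open>\<tau>\<close> by one, and
  \<open>directed_tree_unique_path\<close> compares paths in this form.\<close>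

definition tpath :: "nat \<Rightarrow> nat \<Rightarrow> bool" where
  "tpath i j \<longleftrightarrow> \<tau> i \<le> \<tau> j \<and> (\<exists>g. g (\<tau> i) = i \<and> g (\<tau> j) = j \<and>
    (\<forall>t. \<tau> i \<le> t \<longrightarrow> t < \<tau> j \<longrightarrow> (g t, g (Suc t)) \<in> parcs T))"

text \<open>Stronger than transitivity: the composed path is known to pass through \<open>j\<close>,
  and it is this middle node that uniqueness of paths will identify.\<close>

lemma tpath_through:
  assumes "tpath i j" "tpath j k"
  obtains g where "g (\<tau> i) = i" "g (\<tau> j) = j" "g (\<tau> k) = k"
    "\<And>t. \<tau> i \<le> t \<Longrightarrow> t < \<tau> k \<Longrightarrow> (g t, g (Suc t)) \<in> parcs T"
proof -
  obtain g where g: "g (\<tau> i) = i" "g (\<tau> j) = j" "\<tau> i \<le> \<tau> j"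
    "\<And>t. \<tau> i \<le> t \<Longrightarrow> t < \<tau> j \<Longrightarrow> (g t, g (Suc t)) \<in> parcs T"
    using assms(1) unfolding tpath_def by auto
  obtain h where h: "h (\<tau> j) = j" "h (\<tau> k) = k" "\<tau> j \<le> \<tau> k"
    "\<And>t. \<tau> j \<le> t \<Longrightarrow> t < \<tau> k \<Longrightarrow> (h t, h (Suc t)) \<in> parcs T"
    using assms(2) unfolding tpath_def by auto
  let ?f = "\<lambda>t. if t \<le> \<tau> j then g t else h t"
  have arc: "(?f t, ?f (Suc t)) \<in> parcs T" if t: "\<tau> i \<le> t" "t < \<tau> k" for t
  proof -
    consider "t < \<tau> j" | "t = \<tau> j" | "\<tau> j < t" by linarith
    then show ?thesis
    proof cases
      case 1
      then show ?thesis using g(4)[of t] t by simp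
    next
      case 2
      then have "?f t = h t" using g(2) h(1) by simp
      then show ?thesis using h(4)[of t] 2 t by simp
    next
      case 3
      then show ?thesis using h(4)[of t] t by simp
    qed
  qed
  have "?f (\<tau> k) = k"
  proof (cases "\<tau> k \<le> \<tau> j")
    case True
    then have "\<tau> k = \<tau> j" using h(3) by (rule le_antisym)
    then show ?thesis using g(2) h(1,2) by simp
  qed (use h(2) in simp)
  with arc show thesis using g(1,2,3) by (intro that[of ?f]) auto
qed

lemma tpathI:
  assumes "g (\<tau> i) = i" "g (\<tau> j) = j" "\<tau> i \<le> \<tau> j"
    and "\<And>t. \<tau> i \<le> t \<Longrightarrow> t < \<tau> j \<Longrightarrow> (g t, g (Suc t)) \<in> parcs T"
  shows "tpath i j"
  unfolding tpath_def using assms by (intro conjI exI[of _ g]) auto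

lemma tpath_trans:
  assumes "tpath i j" "tpath j k"
  shows "tpath i k"
proof (rule tpath_through[OF assms], rule tpathI)
  show "\<tau> i \<le> \<tau> k" using assms unfolding tpath_def by (elim conjE) (rule order_trans)
qed

lemma tpath_bag:
  assumes "v < n" "1 \<le> t" "t \<le> t'" "t' \<le> L"
  shows "tpath (bag v t) (bag v t')"
proof (rule tpathI[where g = "bag v"])
  fix r assume "\<tau> (bag v t) \<le> r" "r < \<tau> (bag v t')"
  then show "(bag v r, bag v (Suc r)) \<in> parcs T" using assms bag(3)[of v] by (intro bag_arc) auto
qed (use assms bag(3)[of v] in auto)

lemma L_pos: "1 \<le> L"
proof -
  obtain e t where "(e, t) \<in> time_edges G" using nonempty by auto
  then show ?thesis using time_edge_le_lifetime(1)[OF temporal_graph] L by fastforce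
qed

text \<open>Waiting at a vertex follows the path of its bags, and crossing a time-edge stays in the
  bag shared by its ends. The last arc had time \<open>s - 1\<close>; after a source arc this is 0,
  a time without bags, hence the maximum with 1.\<close>

lemma tpath_visited:
  "(x, s, V) \<in> confs n A L \<Longrightarrow> x < n \<Longrightarrow> v \<in> V \<Longrightarrow> tpath (bag v 1) (bag x (max 1 (s - 1)))"
proof (induction "(x, s, V)" arbitrary: x s V rule: confs.induct)
  case root then show ?case by simp
next
  case (step c)
  obtain x' s' V' where c: "c = (x', s', V')" by (cases c)
  obtain t where t: "(x', x, t) \<in> set A" "s' \<le> t" "s = Suc t" "V = insert x V'"
    using step(4) unfolding c succs_def by auto
  show ?case
  proof (cases "x' < n")
    case True
    then have e: "({x', x}, t) \<in> time_edges G" using t(1) arc_vertex by simp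
    then have t1: "1 \<le> t" "t \<le> L" using time_edgeD L by auto
    have "tpath (bag v 1) (bag x t)"
    proof (cases "v \<in> V'")
      case True
      then have "tpath (bag v 1) (bag x' (max 1 (s' - 1)))"
        using step(2)[OF c \<open>x' < n\<close>] by simp
      moreover have "tpath (bag x' (max 1 (s' - 1))) (bag x' t)"
        using \<open>x' < n\<close> t t1 by (intro tpath_bag) auto
      ultimately show ?thesis using bag_time_edge[OF e] tpath_trans by metis
    next
      case False
      then have "v = x" using step.prems t(4) by simp
      then show ?thesis using t1 step.prems by (auto intro: tpath_bag)
    qed
    then show ?thesis using t(3) t1 by (simp add: max_def)
  next
    case False
    then have "(x', s', V') = (n, 0, {})" using confs_bounds[of x' s' V'] step(1) c by auto
    moreover from this have "t = 0" using t(1) arc_source by auto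
    ultimately show ?thesis using t step.prems L_pos by (auto intro!: tpath_bag)
  qed
qed

text \<open>The last time processed by stage \<open>k\<close> is \<open>k - 1\<close>; the maximum
  with \<open>\<sigma>\<close> covers the stages in which no arc is usable yet. All arcs of time
  \<open>k\<close> followed from a vertex lie in one bag, so chaining several of them within a pass
  does not change the node of \<open>T\<close>.\<close>

lemma tpath_reach:
  assumes x: "x < n" and s: "s \<le> Suc L" and \<sigma>: "\<sigma> = max 1 (s - 1)"
  shows "k \<le> Suc L \<Longrightarrow> w \<in> reach A x s k \<Longrightarrow> w < n \<and> tpath (bag x \<sigma>) (bag w (max \<sigma> (k - 1)))"
proof (induction k arbitrary: w)
  case 0
  then show ?case using x s L_pos unfolding \<sigma> by (auto intro!: tpath_bag)
next
  case (Suc k)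
  let ?P = "\<lambda>w. w < n \<and> tpath (bag x \<sigma>) (bag w (max \<sigma> k))"
  have \<sigma>L: "1 \<le> \<sigma>" "\<sigma> \<le> L" using s L_pos unfolding \<sigma> by auto
  have "?P w"
  proof (rule fold_relax_induct[where P = ?P and R = "reach A x s k" and A = A and s = s and t = k])
    fix w assume "w \<in> reach A x s k"
    then have w: "w < n" "tpath (bag x \<sigma>) (bag w (max \<sigma> (k - 1)))"
      using Suc.IH Suc.prems(1) by auto
    have "tpath (bag w (max \<sigma> (k - 1))) (bag w (max \<sigma> k))"
      using w(1) \<sigma>L Suc.prems(1) by (intro tpath_bag) auto
    then show "?P w" using w tpath_trans by blast
  next
    fix u v assume a: "(u, v, k) \<in> set A" "s \<le> k" "?P u"
    then have e: "({u, v}, k) \<in> time_edges G" using arc_vertex by simp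
    then have "max \<sigma> k = k" "v < n" using time_edgeD[OF e] a(2) unfolding \<sigma> by auto
    then show "?P v" using a(3) bag_time_edge[OF e] by simp
  next
    show "w \<in> fold (relax s k) A (reach A x s k)" using Suc.prems by simp
  qed
  then show ?case by simp
qed



lemma visited_reach_subset_bag:
  assumes conf: "(x, s, V) \<in> confs n A L" and x: "x < n"
  shows "V \<inter> reach A x s (Suc L) \<subseteq> B (bag x (max 1 (s - 1)))"
proof
  fix v assume v: "v \<in> V \<inter> reach A x s (Suc L)"
  define \<sigma> where "\<sigma> = max 1 (s - 1)"
  have b: "s \<le> Suc L" "v < n" using confs_bounds[OF conf] x v by auto
  have \<sigma>: "1 \<le> \<sigma>" "\<sigma> \<le> L" using b L_pos unfolding \<sigma>_def by auto
  have before: "tpath (bag v 1) (bag x \<sigma>)" using tpath_visited[OF conf x] v unfolding \<sigma>_def by auto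
  have after: "tpath (bag x \<sigma>) (bag v L)"
    using tpath_reach[OF x b(1) \<sigma>_def, of "Suc L" v] v \<sigma> by (simp add: max_absorb2 del: reach.simps)
  have \<tau>: "\<tau> (bag v 1) = 1" "\<tau> (bag x \<sigma>) = \<sigma>" "\<tau> (bag v L) = L"
    using bag(3)[OF b(2)] bag(3)[OF x \<sigma>] L_pos by auto
  \<comment> \<open>Time 1 and time \<open>L\<close> serve as common ends: \<open>before\<close>
    starts and \<open>after\<close> finishes at a bag of \<open>v\<close>, so \<open>g\<close> can
    be compared with the path of the bags of \<open>v\<close>.\<close>
  obtain g where g: "g 1 = bag v 1" "g \<sigma> = bag x \<sigma>" "g L = bag v L"
    "\<And>t. 1 \<le> t \<Longrightarrow> t < L \<Longrightarrow> (g t, g (Suc t)) \<in> parcs T"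
    by (rule tpath_through[OF before after, unfolded \<tau>]) (rule that)
  have tree: "directed_tree T" using TIM by (simp add: TIM_decomposition_def)
  have "g \<sigma> = bag v \<sigma>"
  proof (rule directed_tree_unique_path[OF tree, where \<tau> = \<tau> and ?a0.0 = 1 and ?c0.0 = L
        and g = g and h = "bag v"])
    show "\<tau> j = Suc (\<tau> i)" if "(i, j) \<in> parcs T" for i j using that parcs by auto
    show "\<tau> (g 1) = 1" using g(1) bag(3)[OF b(2)] L_pos by simp
  qed (use g \<sigma> bag_arc[OF b(2)] in auto)
  then show "v \<in> B (bag x (max 1 (s - 1)))"
    using g(2) bag(2)[OF b(2) \<sigma>] unfolding \<sigma>_def by simp
qed

text \<open>For fixed \<open>x\<close> and \<open>s\<close>, goodness puts every vertex outside
  \<open>?R\<close> into \<open>V\<close>. So \<open>V\<close> is determined by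
  \<open>V \<inter> ?R\<close>, a subset of one bag. There are \<open>n * Suc L\<close> pairs
  \<open>(x, s)\<close> away from the source, and the summand 1 is for the root.\<close>

lemma card_good_confs_le:
  "card {c \<in> confs n A L. good n A L c} \<le> 1 + n * Suc L * 2 ^ TIM_decomposition_width T B"
proof -
  let ?H = "{c \<in> confs n A L. good n A L c}" and ?W = "TIM_decomposition_width T B"
  let ?S = "\<lambda>x s. {V. (x, s, V) \<in> ?H}"
  have fiber: "card (?S x s) \<le> 2 ^ ?W" if x: "x < n" and s: "s \<le> Suc L" for x s
  proof -
    let ?b = "bag x (max 1 (s - 1))" and ?R = "reach A x s (Suc L)"
    have b: "?b \<in> pverts T" using x s L_pos by (intro bag) auto
    have "finite (pverts T)"
      using TIM by (simp add: TIM_decomposition_def directed_tree_def pair_fin_digraph_def pair_fin_digraph_axioms_def)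
    then have card: "card (B ?b) \<le> ?W" unfolding TIM_decomposition_width_def using b by (intro Max_ge) auto
    have "B ?b \<subseteq> {..<n}" using TIM b unfolding TIM_decomposition_def vertices by auto
    then have fin: "finite (B ?b)" by (rule finite_subset) simp
    have "inj_on (\<lambda>V. V \<inter> ?R) (?S x s)"
    proof (rule inj_onI)
      fix V V' assume V: "V \<in> ?S x s" "V' \<in> ?S x s" and eq: "V \<inter> ?R = V' \<inter> ?R"
      have "V \<subseteq> {..<n}" "V' \<subseteq> {..<n}" using V confs_bounds x by fastforce+
      moreover have "{..<n} - V \<subseteq> ?R" "{..<n} - V' \<subseteq> ?R" using V by (auto simp: good_def)
      ultimately show "V = V'" using eq by blast
    qed
    moreover have "(\<lambda>V. V \<inter> ?R) ` ?S x s \<subseteq> Pow (B ?b)"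
      using visited_reach_subset_bag[OF _ x] by (auto simp del: reach.simps)
    ultimately have "card (?S x s) \<le> card (Pow (B ?b))"
      using fin by (intro card_inj_on_le) auto
    also have "\<dots> \<le> 2 ^ ?W" using card fin by (simp add: card_Pow)
    finally show ?thesis .
  qed
  let ?I = "{..<n} \<times> {1..Suc L}"
  let ?U = "\<Union>(x, s)\<in>?I. (\<lambda>V. (x, s, V)) ` ?S x s"
  have finS: "finite (?S x s)" for x s
    by (rule finite_subset[of _ "(snd \<circ> snd) ` ?H"]) (use finite_good_confs in \<open>force+\<close>)
  have "?H \<subseteq> insert (n, 0, {}) ?U"
    using confs_bounds by fastforce
  then have "card ?H \<le> card (insert (n, 0, {}) ?U)"
    using finS by (intro card_mono) auto
  also have "\<dots> \<le> 1 + card ?U"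
    using finS by (simp add: card_insert_if)
  also have "card ?U \<le> (\<Sum>(x, s)\<in>?I. card ((\<lambda>V. (x, s, V)) ` ?S x s))"
    using card_UN_le[of ?I "\<lambda>(x, s). (\<lambda>V. (x, s, V)) ` ?S x s"] by (simp add: case_prod_unfold)
  also have "\<dots> \<le> (\<Sum>(x, s)\<in>?I. 2 ^ ?W)"
    using fiber card_image_le[OF finS] by (intro sum_mono) (fastforce intro: order_trans)
  also have "\<dots> = n * Suc L * 2 ^ ?W" by simp
  finally show ?thesis by simp
qed

end

section \<open>The program\<close>

text \<open>
  The arcs \<open>(u, v, t)\<close> are stored in the arrays \<open>u\<close>, \<open>v\<close>, \<open>t\<close>, and the configurations \<open>(x, s, V)\<close>
  found so far in \<open>qx\<close>, \<open>qs\<close>, \<open>qm\<close>, where \<open>qm\<close> holds \<open>V\<close> as a bit mask and \<open>h\<close> is the next one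
  to be expanded.  As there is no division, masks are decoded by subtracting the powers of two
  in \<open>w\<close>, starting with the largest.
\<close>

notation Seq (infixr \<open>;;\<close> 55)

abbreviation One :: aexp where "One \<equiv> Num 1"

abbreviation Inc :: "string \<Rightarrow> com" where
  "Inc x \<equiv> Set x (Plus (Var x) One)"

definition decode_visited :: com where
  "decode_visited =
    Set ''r'' (Cell ''qm'' (Var ''h'')) ;;
    For ''i'' (Var ''n'')
      (Cond (Less (Var ''r'') (Cell ''w'' (Minus (Var ''n'') (Plus (Var ''i'') One))))
        (Assign ''vis'' (Minus (Var ''n'') (Plus (Var ''i'') One)) (Num 0))
        (Assign ''vis'' (Minus (Var ''n'') (Plus (Var ''i'') One)) One ;;
         Set ''r'' (Minus (Var ''r'') (Cell ''w'' (Minus (Var ''n'') (Plus (Var ''i'') One))))))"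

text \<open>\<open>n + 1\<close> cells are cleared since the start may be the source
  \<open>n\<close>, and the outer loop makes \<open>L + 1\<close> rounds to include time
  \<open>L\<close>.\<close>

definition compute_reach :: com where
  "compute_reach =
    For ''i'' (Plus (Var ''n'') One) (Assign ''re'' (Var ''i'') (Num 0)) ;;
    Assign ''re'' (Var ''x'') One ;;
    For ''i'' (Plus (Var ''L'') One)
      (For ''j'' (Var ''m'')
        (Cond (Conj (Neg (Less (Var ''i'') (Var ''s'')))
                (Conj (Equal (Cell ''t'' (Var ''j'')) (Var ''i''))
                  (Equal (Cell ''re'' (Cell ''u'' (Var ''j''))) One)))
          (Assign ''re'' (Cell ''v'' (Var ''j'')) One) Skip))"

definition test_good :: com where
  "test_good =
    Set ''ok'' One ;;
    For ''i'' (Var ''n'')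
      (Cond (Conj (Equal (Cell ''vis'' (Var ''i'')) (Num 0)) (Neg (Equal (Cell ''re'' (Var ''i'')) One)))
        (Set ''ok'' (Num 0)) Skip)"

definition enqueue :: com where
  "enqueue =
    Set ''found'' (Num 0) ;;
    For ''k'' (Var ''q'')
      (Cond (Conj (Equal (Cell ''qx'' (Var ''k'')) (Var ''y''))
              (Conj (Equal (Cell ''qs'' (Var ''k'')) (Var ''ys''))
                (Equal (Cell ''qm'' (Var ''k'')) (Var ''ym''))))
        (Set ''found'' One) Skip) ;;
    Cond (Equal (Var ''found'') (Num 0))
      (Assign ''qx'' (Var ''q'') (Var ''y'') ;;
       Assign ''qs'' (Var ''q'') (Var ''ys'') ;;
       Assign ''qm'' (Var ''q'') (Var ''ym'') ;;
       Inc ''q'')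
      Skip"

text \<open>The new vertex is unvisited, so adding its power of two sets one bit of the mask without
  a carry.\<close>

definition expand :: com where
  "expand =
    For ''j'' (Var ''m'')
      (Cond (Conj (Equal (Cell ''u'' (Var ''j'')) (Var ''x''))
              (Conj (Neg (Less (Cell ''t'' (Var ''j'')) (Var ''s'')))
                (Equal (Cell ''vis'' (Cell ''v'' (Var ''j''))) (Num 0))))
        (Set ''y'' (Cell ''v'' (Var ''j'')) ;;
         Set ''ys'' (Plus (Cell ''t'' (Var ''j'')) One) ;;
         Set ''ym'' (Plus (Cell ''qm'' (Var ''h'')) (Cell ''w'' (Cell ''v'' (Var ''j'')))) ;;
         enqueue)
        Skip)"

text \<open>The full mask is \<open>2 ^ n - 1\<close>, hence the comparison of its successor with
  \<open>w n\<close>. The test \<open>x < n\<close> matters for \<open>n = 0\<close>: there the root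
  has visited all vertices, yet a path needs at least one.\<close>

definition search_body :: com where
  "search_body =
    Set ''x'' (Cell ''qx'' (Var ''h'')) ;;
    Set ''s'' (Cell ''qs'' (Var ''h'')) ;;
    Cond (Conj (Less (Var ''x'') (Var ''n''))
           (Equal (Plus (Cell ''qm'' (Var ''h'')) One) (Cell ''w'' (Var ''n''))))
      (Set ''output'' One) Skip ;;
    decode_visited ;;
    compute_reach ;;
    test_good ;;
    Cond (Equal (Var ''ok'') One) expand Skip ;;
    Inc ''h''"

definition search :: com where
  "search =
    Assign ''qx'' (Num 0) (Var ''n'') ;;
    Assign ''qs'' (Num 0) (Num 0) ;;
    Assign ''qm'' (Num 0) (Num 0) ;;
    Set ''h'' (Num 0) ;;
    Set ''q'' One ;;
    While (Less (Var ''h'') (Var ''q'')) search_body"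

definition push_arc :: "aexp \<Rightarrow> aexp \<Rightarrow> aexp \<Rightarrow> com" where
  "push_arc a b c =
    Assign ''u'' (Var ''m'') a ;;
    Assign ''v'' (Var ''m'') b ;;
    Assign ''t'' (Var ''m'') c ;;
    Inc ''m''"

definition read_edge :: com where
  "read_edge =
    Set ''a'' (Cell ''input'' (Var ''p'')) ;;
    Set ''b'' (Cell ''input'' (Plus (Var ''p'') One)) ;;
    Set ''c'' (Cell ''input'' (Plus (Var ''p'') (Num 2))) ;;
    Set ''p'' (Plus (Var ''p'') (Num 3)) ;;
    For ''j'' (Var ''c'')
      (push_arc (Var ''a'') (Var ''b'') (Cell ''input'' (Var ''p'')) ;;
       push_arc (Var ''b'') (Var ''a'') (Cell ''input'' (Var ''p'')) ;;
       Cond (Less (Var ''L'') (Cell ''input'' (Var ''p'')))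
         (Set ''L'' (Cell ''input'' (Var ''p''))) Skip ;;
       Inc ''p'')"

text \<open>The counters \<open>m\<close> and \<open>L\<close> rely on the initial memory, which is
  0 outside \<open>input\<close>. Reading of the edges starts at position 2, behind the two header
  numbers.\<close>

definition read_instance :: com where
  "read_instance =
    Set ''n'' (Cell ''input'' (Num 0)) ;;
    Assign ''w'' (Num 0) One ;;
    For ''i'' (Var ''n'')
      (Assign ''w'' (Plus (Var ''i'') One) (Plus (Cell ''w'' (Var ''i'')) (Cell ''w'' (Var ''i'')))) ;;
    For ''i'' (Var ''n'') (push_arc (Var ''n'') (Var ''i'') (Num 0)) ;;
    Set ''p'' (Num 2) ;;
    For ''i'' (Cell ''input'' One) read_edge"

section \<open>Correctness of the program\<close>

text \<open>The frame condition: only arrays named in \<open>X\<close> may have changed. All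
  subprograms are specified with it, so that facts about other arrays carry over by comparing
  names.\<close>

definition agree :: "string set \<Rightarrow> state \<Rightarrow> state \<Rightarrow> bool" where
  "agree X s s' \<longleftrightarrow> (\<forall>z. z \<notin> X \<longrightarrow> s' z = s z)"

lemma agree_refl [simp]: "agree X s s"
  by (simp add: agree_def)

lemma agree_update [simp]: "x \<in> X \<Longrightarrow> agree X s (s'(x := f)) \<longleftrightarrow> agree X s s'"
  by (auto simp: agree_def)

lemma agreeD: "agree X s s' \<Longrightarrow> z \<notin> X \<Longrightarrow> s' z = s z"
  by (simp add: agree_def)



definition arcs_of :: "state \<Rightarrow> arc list" where
  "arcs_of s = map (\<lambda>k. (s ''u'' k, s ''v'' k, s ''t'' k)) [0..<s ''m'' 0]"

definition queue_of :: "state \<Rightarrow> (nat \<times> nat \<times> nat) list" where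
  "queue_of s = map (\<lambda>k. (s ''qx'' k, s ''qs'' k, s ''qm'' k)) [0..<s ''q'' 0]"

lemma length_arcs_of [simp]: "length (arcs_of s) = s ''m'' 0"
  by (simp add: arcs_of_def)

lemma nth_arcs_of: "k < s ''m'' 0 \<Longrightarrow> arcs_of s ! k = (s ''u'' k, s ''v'' k, s ''t'' k)"
  by (simp add: arcs_of_def)

lemma length_queue_of [simp]: "length (queue_of s) = s ''q'' 0"
  by (simp add: queue_of_def)

lemma nth_queue_of: "k < s ''q'' 0 \<Longrightarrow> queue_of s ! k = (s ''qx'' k, s ''qs'' k, s ''qm'' k)"
  by (simp add: queue_of_def)

text \<open>The reason why greedy decoding works: all lower bits together stay below the next power
  of two.\<close>

lemma set_encode_less:
  assumes "V \<subseteq> {..<i}"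
  shows "set_encode V < 2 ^ i"
proof -
  have "set_encode V \<le> set_encode {..<i}"
    unfolding set_encode_def using assms by (intro sum_mono2) auto
  also have "\<dots> < 2 ^ i"
    unfolding set_encode_def by (induction i) auto
  finally show ?thesis .
qed

lemma set_encode_split:
  "set_encode (V \<inter> {..<Suc i}) = (if i \<in> V then 2 ^ i else 0) + set_encode (V \<inter> {..<i})"
proof -
  have "V \<inter> {..<Suc i} = (if i \<in> V then insert i (V \<inter> {..<i}) else V \<inter> {..<i})"
    by (auto simp: less_Suc_eq)
  then show ?thesis by simp
qed

lemma run_decode_visited:
  assumes n: "s ''n'' 0 = n" and w: "\<And>i. i < n \<Longrightarrow> s ''w'' i = 2 ^ i"
    and V: "V \<subseteq> {..<n}" and qm: "s ''qm'' (s ''h'' 0) = set_encode V"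
  shows "run decode_visited s (\<lambda>t s'. t \<le> 100 * (n + 1) \<and> agree {''r'', ''i'', ''vis''} s s' \<and>
    (\<forall>i<n. s' ''vis'' i = of_bool (i \<in> V)))"
  unfolding decode_visited_def run_Seq run_Assign
proof (rule run_For[where N = n and K = 40 and I = "\<lambda>k s'.
    agree {''r'', ''i'', ''vis''} s s' \<and> s' ''r'' 0 = set_encode (V \<inter> {..<n - k}) \<and>
    (\<forall>i. n - k \<le> i \<longrightarrow> i < n \<longrightarrow> s' ''vis'' i = of_bool (i \<in> V))"], goal_cases)
  case 1
  then show ?case using V qm by (simp add: Int_absorb2)
next
  case (2 k s')
  then have "s' ''n'' = s ''n''" by (auto simp: agree_def)
  then show ?case using n by simp
next
  case (3 k s')
  \<comment> \<open>Iteration \<open>k\<close> decides bit \<open>n - Suc k\<close>. By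
    \<open>less\<close> below, the remainder is smaller than \<open>2 ^ i\<close> exactly if this
    bit is absent.\<close>
  define i where "i = n - Suc k"
  have i: "n - k = Suc i" "i < n" using 3 by (auto simp: i_def)
  have e: "s' ''n'' = s ''n''" "s' ''w'' = s ''w''" using 3 by (auto simp: agree_def)
  have ws: "s' ''w'' i = 2 ^ i" using w i e by simp
  have idx: "aval (Minus (Var ''n'') (Plus (Var ''i'') One)) s' = i"
    using 3 n e by (simp add: i_def)
  have less: "set_encode (V \<inter> {..<i}) < 2 ^ i" by (rule set_encode_less) simp
  have r: "s' ''r'' 0 = (if i \<in> V then 2 ^ i else 0) + set_encode (V \<inter> {..<i})"
    using 3 by (simp only: i set_encode_split)
  have vis: "s' ''vis'' j = of_bool (j \<in> V)" if "j \<noteq> i" "i \<le> j" "j < n" for j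
    using 3 that i by auto
  show ?case
    using 3 less ws vis i
    by (simp add: i_def[symmetric] n e set_encode_split)
next
  case (4 t s')
  then show ?case by simp
qed

text \<open>The data that stay fixed during the search. The powers of two extend to index
  \<open>n\<close> itself for the comparison with the full mask.\<close>

definition represents :: "nat \<Rightarrow> arc list \<Rightarrow> nat \<Rightarrow> state \<Rightarrow> bool" where
  "represents n A L s \<longleftrightarrow>
    s ''n'' 0 = n \<and> s ''L'' 0 = L \<and> arcs_of s = A \<and> (\<forall>i\<le>n. s ''w'' i = 2 ^ i)"

lemma represents_agree:
  assumes "represents n A L s" "agree X s s'" "X \<inter> {''n'', ''L'', ''u'', ''v'', ''t'', ''m'', ''w''} = {}"
  shows "represents n A L s'"
proof -
  have "s' z = s z" if "z \<in> {''n'', ''L'', ''u'', ''v'', ''t'', ''m'', ''w''}" for z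
    using assms(2,3) that unfolding agree_def by blast
  then show ?thesis using assms(1) by (simp add: represents_def arcs_of_def)
qed

lemma representsD:
  assumes "represents n A L s"
  shows "s ''n'' 0 = n" "s ''L'' 0 = L" "s ''m'' 0 = length A" "i \<le> n \<Longrightarrow> s ''w'' i = 2 ^ i"
    "k < length A \<Longrightarrow> A ! k = (s ''u'' k, s ''v'' k, s ''t'' k)"
  using assms nth_arcs_of[of k s] length_arcs_of[of s] unfolding represents_def by auto

text \<open>The invariant of the inner loop is the fold over the arcs seen so far, so the array
  follows \<open>relax\<close> arc by arc and inherits its dependence on the order within a time
  step.\<close>

lemma run_compute_reach:
  assumes rep: "represents n A L s" and A: "\<And>a b c. (a, b, c) \<in> set A \<Longrightarrow> a \<le> n \<and> b < n"
    and x: "s ''x'' 0 \<le> n"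
  shows "run compute_reach s (\<lambda>t s'. t \<le> 200 * (n + 2) + 200 * (L + 2) * (length A + 1) \<and>
    agree {''re'', ''i'', ''j''} s s' \<and>
    (\<forall>i\<le>n. s' ''re'' i = 1 \<longleftrightarrow> i \<in> reach A (s ''x'' 0) (s ''s'' 0) (Suc L)))"
proof -
  let ?X = "{''re'', ''i'', ''j''}"
  let ?R = "reach A (s ''x'' 0) (s ''s'' 0)"
  let ?re = "\<lambda>s' R. \<forall>i\<le>n. s' ''re'' i = 1 \<longleftrightarrow> i \<in> R"
  have rep': "represents n A L s'" if "agree ?X s s'" for s'
    using rep that by (rule represents_agree) simp
  have xs: "s' ''x'' = s ''x''" "s' ''s'' = s ''s''" if "agree ?X s s'" for s'
    using that by (auto simp: agree_def)
  show ?thesis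
    unfolding compute_reach_def run_Seq
  proof (rule run_For[where N = "n + 1" and K = 10 and I = "\<lambda>k s'. agree ?X s s' \<and> (\<forall>i<k. s' ''re'' i = 0)"],
      goal_cases)
    case 1
    show ?case by simp
  next
    case (2 k s')
    then have "agree ?X s s'" by (elim conjE)
    from representsD(1)[OF rep'[OF this]] show ?case by simp
  next
    case (3 k s')
    then show ?case by (simp add: less_Suc_eq)
  next
    case (4 t1 s1)
    let ?s2 = "update_cell s1 ''re'' (s ''x'' 0) 1"
    have s1: "s1 ''x'' = s ''x''" using 4(2) xs(1)[of s1] by (elim conjE)
    have zero: "s1 ''re'' i = 0" if "i \<le> n" for i using 4(2) that by simp
    have init: "?re ?s2 (?R 0)" by (simp add: zero)
    show ?case
      unfolding run_Assign
    proof (rule run_For[where N = "L + 1" and K = "3 + (length A + 1) * 60" and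
          I = "\<lambda>k s'. agree ?X s s' \<and> ?re s' (?R k)"], goal_cases)
      case 1
      then show ?case using 4 init s1 by simp
    next
      case (2 k s')
      then have "agree ?X s s'" by (elim conjE)
      from representsD(2)[OF rep'[OF this]] show ?case by simp
    next
      case (3 k s')
      show ?case
      proof (rule run_For[where N = "length A" and K = 40 and
          I = "\<lambda>j s'. agree ?X s s' \<and> s' ''i'' 0 = k \<and> ?re s' (fold (relax (s ''s'' 0) k) (take j A) (?R k))"],
          goal_cases)
        case 1
        then show ?case using 3 by simp
      next
        case (2 j s')
        then have "agree ?X s s'" by (elim conjE)
        from representsD(3)[OF rep'[OF this]] show ?case by simp
      next
        case (3 j s'')
        have r: "agree ?X s s''" using 3 by simp
        note D = representsD[OF rep'[OF r]] xs[OF r]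
        have arc: "A ! j = (s'' ''u'' j, s'' ''v'' j, s'' ''t'' j)" using D(5) 3 by simp
        then have "(s'' ''u'' j, s'' ''v'' j, s'' ''t'' j) \<in> set A" using 3(3) nth_mem by metis
        from A[OF this] have uv: "s'' ''u'' j \<le> n" "s'' ''v'' j < n" by auto
        let ?F = "\<lambda>j. fold (relax (s ''s'' 0) k) (take j A) (?R k)"
        have "?F (Suc j) = relax (s ''s'' 0) k (A ! j) (?F j)"
          using 3(3) by (simp add: take_Suc_conv_app_nth)
        then have F: "?F (Suc j) = (if s ''s'' 0 \<le> k \<and> s'' ''t'' j = k \<and> s'' ''u'' j \<in> ?F j
            then insert (s'' ''v'' j) (?F j) else ?F j)"
          by (simp only: arc relax_Pair)
        have re: "\<forall>i\<le>n. (s'' ''re'' i = 1) = (i \<in> ?F j)" using 3(1) by (elim conjE)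
        have u: "s'' ''re'' (s'' ''u'' j) = 1 \<longleftrightarrow> s'' ''u'' j \<in> ?F j"
          using re uv(1) by (elim allE impE)
        show ?case
        proof (cases "s ''s'' 0 \<le> k \<and> s'' ''t'' j = k \<and> s'' ''u'' j \<in> ?F j")
          case True
          from F[unfolded if_P[OF this]] have "?F (Suc j) = insert (s'' ''v'' j) (?F j)" .
          then show ?thesis using True u re 3 D(7) uv(2) by simp
        next
          case False
          from F[unfolded if_not_P[OF this]] have "?F (Suc j) = ?F j" .
          then show ?thesis using False u re 3 D(7) by auto
        qed
      next
        case (4 t s'')
        then show ?case using \<open>s' ''i'' 0 = k\<close> by simp
      qed
    next
      case (4 t2 s2)
      have "t1 \<le> 3 + (n + 2) * 24" using \<open>t1 \<le> _\<close> by simp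
      moreover have "t2 \<le> 3 + (L + 2) * (14 + (3 + (length A + 1) * 60))" using 4(1) by simp
      ultimately show ?case using 4 by (simp add: algebra_simps)
    qed
  qed
qed

lemma run_test_good:
  assumes n: "s ''n'' 0 = n"
  shows "run test_good s (\<lambda>t s'. t \<le> 100 * (n + 1) \<and> agree {''ok'', ''i''} s s' \<and>
    (s' ''ok'' 0 = 1 \<longleftrightarrow> (\<forall>i<n. s ''vis'' i = 0 \<longrightarrow> s ''re'' i = 1)))"
  unfolding test_good_def run_Seq run_Assign
proof (rule run_For[where N = n and K = 40 and I = "\<lambda>k s'. agree {''ok'', ''i''} s s' \<and>
    (s' ''ok'' 0 = 1 \<longleftrightarrow> (\<forall>i<k. s ''vis'' i = 0 \<longrightarrow> s ''re'' i = 1))"], goal_cases)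
  case 1
  show ?case by simp
next
  case (2 k s')
  then have "s' ''n'' = s ''n''" by (auto simp: agree_def)
  then show ?case using n by simp
next
  case (3 k s')
  then have "s' ''vis'' = s ''vis''" "s' ''re'' = s ''re''" by (auto simp: agree_def)
  then show ?case using 3 by (auto simp: less_Suc_eq)
next
  case (4 t s')
  then show ?case by simp
qed

text \<open>The cost is stated for any \<open>C\<close> above the queue length, so that one constant
  serves for all insertions while the queue grows.\<close>

lemma run_enqueue:
  defines "c \<equiv> \<lambda>s. (s ''y'' 0, s ''ys'' 0, s ''ym'' 0)"
  assumes q: "s ''q'' 0 \<le> C"
  shows "run enqueue s (\<lambda>t s'. t \<le> 100 * (C + 1) \<and> agree {''k'', ''found'', ''qx'', ''qs'', ''qm'', ''q''} s s' \<and>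
    (\<forall>i < s ''q'' 0. s' ''qm'' i = s ''qm'' i) \<and>
    queue_of s' = (if c s \<in> set (queue_of s) then queue_of s else queue_of s @ [c s]))"
proof -
  let ?X = "{''k'', ''found'', ''qx'', ''qs'', ''qm'', ''q''}"
  have Q: "c s \<in> set (queue_of s) \<longleftrightarrow> (\<exists>i<s ''q'' 0. s ''qx'' i = s ''y'' 0 \<and> s ''qs'' i = s ''ys'' 0 \<and> s ''qm'' i = s ''ym'' 0)"
    unfolding queue_of_def c_def by (simp add: image_iff Bex_def) metis
  show ?thesis
    unfolding enqueue_def run_Seq run_Assign
  proof (rule run_For[where N = "s ''q'' 0" and K = 40 and I = "\<lambda>k s'. agree {''k'', ''found''} s s' \<and>
    s' ''found'' 0 = of_bool (\<exists>i<k. s ''qx'' i = s ''y'' 0 \<and> s ''qs'' i = s ''ys'' 0 \<and> s ''qm'' i = s ''ym'' 0)"],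
    goal_cases)
    case 1
    show ?case by simp
  next
    case (2 k s')
    then have "s' ''q'' = s ''q''" by (auto simp: agree_def)
    then show ?case by simp
  next
    case (3 k s')
    then have e: "s' ''qx'' = s ''qx''" "s' ''qs'' = s ''qs''" "s' ''qm'' = s ''qm''"
      "s' ''y'' = s ''y''" "s' ''ys'' = s ''ys''" "s' ''ym'' = s ''ym''" by (auto simp: agree_def)
    then show ?case using 3 by (auto simp: less_Suc_eq)
  next
    case (4 t s')
    then have e: "s' ''qx'' = s ''qx''" "s' ''qs'' = s ''qs''" "s' ''qm'' = s ''qm''" "s' ''q'' = s ''q''"
      "s' ''y'' = s ''y''" "s' ''ys'' = s ''ys''" "s' ''ym'' = s ''ym''" by (auto simp: agree_def)
    have f: "s' ''found'' 0 = of_bool (c s \<in> set (queue_of s))" using 4 Q by simp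
    have ag: "agree ?X s s'" using 4 by (auto simp: agree_def)
    have qq: "queue_of s' = queue_of s" by (simp add: queue_of_def e)
    have "t \<le> 3 + (s ''q'' 0 + 1) * 52" using 4(1) by simp
    also have "\<dots> \<le> 3 + (C + 1) * 52" using q by simp
    finally have t: "t \<le> 3 + (C + 1) * 52" .
    show ?case
    proof (cases "c s \<in> set (queue_of s)")
      case True
      then show ?thesis using f ag qq t by (simp add: e)
    next
      case False
      then show ?thesis using f ag t
        by (simp add: e queue_of_def c_def)
    qed
  qed
qed

section \<open>Queue entries as codes of configurations\<close>

definition encode_conf :: "conf \<Rightarrow> nat \<times> nat \<times> nat" where
  "encode_conf = (\<lambda>(x, s, V). (x, s, set_encode V))"

lemma succs_take_Suc:
  assumes "k < length A" "A ! k = (u, v, t)"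
  shows "succs (take (Suc k) A) (x, s, V) = (if u = x \<and> s \<le> t \<and> v \<notin> V
    then insert (v, Suc t, insert v V) (succs (take k A) (x, s, V)) else succs (take k A) (x, s, V))"
  using assms by (auto simp: succs_def take_Suc_conv_app_nth)

context temporal_instance
begin

lemma confs_visited: "(x, s, V) \<in> confs n A L \<Longrightarrow> V \<subseteq> {..<n}"
  using confs_bounds by blast

text \<open>Finite sets are determined by their masks, so the duplicate test on queue entries is a
  duplicate test on configurations.\<close>

lemma inj_on_encode_conf: "inj_on encode_conf (confs n A L)"
proof (rule inj_onI)
  fix c c' assume c: "c \<in> confs n A L" "c' \<in> confs n A L" "encode_conf c = encode_conf c'"
  obtain x s V x' s' V' where e: "c = (x, s, V)" "c' = (x', s', V')" by (cases c, cases c')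
  then have "finite V" "finite V'" using c confs_visited finite_subset finite_lessThan by metis+
  then show "c = c'" using c(3) by (simp add: e encode_conf_def set_encode_eq)
qed

lemma length_queue_le:
  assumes "distinct cs" "set cs \<subseteq> confs n A L"
  shows "length cs \<le> card (confs n A L)"
  using card_mono[OF finite_confs assms(2)] distinct_card[OF assms(1)] by simp

text \<open>The queue only grows at its end, by \<open>r\<close>, so entry \<open>h\<close>, whose
  mask is read again for every arc, remains in place. Since the entries are distinct members of
  \<open>confs n A L\<close>, the size of that set bounds every scan.\<close>

lemma run_expand:
  fixes s :: state
  defines "c \<equiv> \<lambda>V. (s ''x'' 0, s ''s'' 0, V)"
  defines "X \<equiv> {''j'', ''y'', ''ys'', ''ym'', ''k'', ''found'', ''qx'', ''qs'', ''qm'', ''q''}"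
  assumes rep: "represents n A L s"
    and queue: "queue_of s = map encode_conf cs"
    and cs: "distinct cs" "set cs \<subseteq> confs n A L"
    and head: "s ''h'' 0 < length cs" "cs ! s ''h'' 0 = c V"
    and vis: "\<And>i. i < n \<Longrightarrow> s ''vis'' i = of_bool (i \<in> V)"
    and sub: "succs A (c V) \<subseteq> confs n A L"
  shows "run expand s (\<lambda>t s'. t \<le> 200 * (length A + 2) * (card (confs n A L) + 2) \<and> agree X s s' \<and>
    (\<exists>r. queue_of s' = map encode_conf (cs @ r) \<and> distinct (cs @ r) \<and>
      set (cs @ r) = set cs \<union> succs A (c V)))"
  unfolding expand_def
proof (rule run_For[where N = "length A" and K = "60 + 100 * (card (confs n A L) + 1)" and
    I = "\<lambda>k s'. agree X s s' \<and>
      (\<exists>r. queue_of s' = map encode_conf (cs @ r) \<and> distinct (cs @ r) \<and>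
        set (cs @ r) = set cs \<union> succs (take k A) (c V))"], goal_cases)
  case 1
  have "queue_of (update_cell s ''j'' 0 0) = queue_of s" by (simp add: queue_of_def)
  then show ?case using queue cs by (auto simp: X_def c_def succs_def intro!: exI[of _ "[]"])
next
  case (2 k s')
  then have "agree X s s'" by (elim conjE)
  then have "s' ''m'' = s ''m''" by (auto simp: agree_def X_def)
  then show ?case using representsD(3)[OF rep] by simp
next
  case (3 k s')
  from 3(1) obtain r where ag: "agree X s s'" and
    r: "queue_of s' = map encode_conf (cs @ r)" "distinct (cs @ r)"
      "set (cs @ r) = set cs \<union> succs (take k A) (c V)"
    by (elim conjE exE)
  have rep': "represents n A L s'"
    using rep ag by (rule represents_agree) (simp add: X_def)
  have e: "s' ''x'' = s ''x''" "s' ''s'' = s ''s''" "s' ''h'' = s ''h''" "s' ''vis'' = s ''vis''"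
    using ag by (auto simp: agree_def X_def)
  let ?u = "s' ''u'' k" and ?v = "s' ''v'' k" and ?t = "s' ''t'' k"
  have arc: "A ! k = (?u, ?v, ?t)" using representsD(5)[OF rep' 3(3)] .
  then have "(?u, ?v, ?t) \<in> set A" using 3(3) nth_mem by metis
  then have v: "?v < n" using arc_endpoints by blast
  let ?K = "60 + 100 * (card (confs n A L) + 1)"
  let ?cond = "?u = s ''x'' 0 \<and> s ''s'' 0 \<le> ?t \<and> ?v \<notin> V"
  have succ: "succs (take (Suc k) A) (c V) = (if ?cond
    then insert (?v, Suc ?t, insert ?v V) (succs (take k A) (c V)) else succs (take k A) (c V))"
    unfolding c_def by (rule succs_take_Suc[OF 3(3) arc])
  have cond: "bval (Conj (Equal (Cell ''u'' (Var ''j'')) (Var ''x''))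
      (Conj (Neg (Less (Cell ''t'' (Var ''j'')) (Var ''s'')))
        (Equal (Cell ''vis'' (Cell ''v'' (Var ''j''))) (Num 0)))) s' \<longleftrightarrow> ?cond"
    using vis[OF v] by (auto simp: e 3(2))
  show ?case
  proof (cases ?cond)
    case False
    have "queue_of (update_cell s' ''j'' 0 (Suc k)) = queue_of s'" by (simp add: queue_of_def)
    with False r ag 3(2) show ?thesis
      unfolding run_Cond cond succ by (auto simp: X_def)
  next
    case True
    let ?c = "(?v, Suc ?t, insert ?v V)"
    have "?c \<in> succs (take (Suc k) A) (c V)" using True unfolding succ by simp
    moreover have take_sub: "succs (take j A) (c V) \<subseteq> succs A (c V)" for j
      unfolding c_def succs_def using set_take_subset[of j A] by auto
    ultimately have cin: "?c \<in> confs n A L" using sub by blast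
    have rsub: "set (cs @ r) \<subseteq> confs n A L"
      using r(3) cs(2) sub take_sub[of k] by blast
    have len: "s' ''q'' 0 \<le> card (confs n A L)"
      using length_queue_le[OF r(2) rsub] length_queue_of[of s'] r(1) by simp
    have "queue_of s' ! s ''h'' 0 = encode_conf (c V)"
      using head by (simp add: r(1) nth_append)
    moreover have "s ''h'' 0 < s' ''q'' 0"
      using head(1) length_queue_of[of s'] r(1) by simp
    ultimately have qm: "s' ''qm'' (s ''h'' 0) = set_encode V"
      using nth_queue_of[of "s ''h'' 0" s'] by (simp add: encode_conf_def c_def)
    have fin: "finite V" using finite_subset[OF confs_visited[OF cin]] by simp
    define s1 where "s1 = update_cell (update_cell (update_cell s' ''y'' 0 ?v) ''ys'' 0 (Suc ?t))
      ''ym'' 0 (set_encode (insert ?v V))"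
    \<comment> \<open>The three assignments cost exactly 22. The stored sum is the mask of
      \<open>insert ?v V\<close> because \<open>?v\<close> is not in \<open>V\<close>.\<close>
    have body: "run (Set ''y'' (Cell ''v'' (Var ''j'')) ;;
         Set ''ys'' (Plus (Cell ''t'' (Var ''j'')) One) ;;
         Set ''ym'' (Plus (Cell ''qm'' (Var ''h'')) (Cell ''w'' (Cell ''v'' (Var ''j'')))) ;;
         enqueue) s' Q \<longleftrightarrow> run enqueue s1 (\<lambda>t. Q (22 + t))" for Q
      using v True fin by (simp add: 3(2) e qm representsD(4)[OF rep'] s1_def eval_nat_numeral add.commute)
    have q1: "queue_of s1 = map encode_conf (cs @ r)" "s1 ''q'' 0 = s' ''q'' 0"
      using r(1) by (simp_all add: s1_def queue_of_def)
    have c1: "(s1 ''y'' 0, s1 ''ys'' 0, s1 ''ym'' 0) = encode_conf ?c"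
      by (simp add: s1_def encode_conf_def)
    have mem: "encode_conf ?c \<in> set (map encode_conf (cs @ r)) \<longleftrightarrow> ?c \<in> set (cs @ r)"
      unfolding set_map by (rule inj_on_image_mem_iff[OF inj_on_encode_conf cin rsub])
    have "run enqueue s1 (\<lambda>t s2. t \<le> 100 * (card (confs n A L) + 1) \<and>
      agree {''k'', ''found'', ''qx'', ''qs'', ''qm'', ''q''} s1 s2 \<and>
      (\<forall>i<s1 ''q'' 0. s2 ''qm'' i = s1 ''qm'' i) \<and>
      queue_of s2 = (if ?c \<in> set (cs @ r) then map encode_conf (cs @ r) else map encode_conf (cs @ r) @ [encode_conf ?c]))"
      using run_enqueue[of s1 "card (confs n A L)"] len unfolding c1 q1 mem by simp
    then show ?thesis
      unfolding run_Cond cond if_P[OF True] body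
    proof (rule run_mono, goal_cases)
      case (1 t s2)
      let ?r = "if ?c \<in> set (cs @ r) then r else r @ [?c]"
      have ag2: "agree X s s2"
        using ag 1 unfolding agree_def X_def s1_def by auto
      have "s2 ''j'' = s1 ''j''" using 1 by (auto simp: agree_def)
      then have j: "s2 ''j'' 0 = k" using 3(2) by (simp add: s1_def)
      have "queue_of (update_cell s2 ''j'' 0 (Suc k)) = queue_of s2" by (simp add: queue_of_def)
      also have "\<dots> = map encode_conf (cs @ ?r)" using 1 by simp
      finally have "queue_of (update_cell s2 ''j'' 0 (Suc k)) = map encode_conf (cs @ ?r)" .
      moreover have "distinct (cs @ ?r)" using r(2) by auto
      moreover have "set (cs @ ?r) = set cs \<union> succs (take (Suc k) A) (c V)"
        unfolding succ if_P[OF True] using r(3) by auto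
      moreover have "agree X s (update_cell s2 ''j'' 0 (Suc k))" using ag2 by (simp add: X_def)
      moreover have "1 + bcost (Conj (Equal (Cell ''u'' (Var ''j'')) (Var ''x''))
        (Conj (Neg (Less (Cell ''t'' (Var ''j'')) (Var ''s'')))
        (Equal (Cell ''vis'' (Cell ''v'' (Var ''j''))) (Num 0)))) + (22 + t) \<le> ?K"
        using 1 by simp
      ultimately show ?case using j by blast
    qed
  qed
next
  case (4 t s')
  have "t \<le> 3 + (length A + 1) * (12 + (60 + 100 * (card (confs n A L) + 1)))" using 4(1) by simp
  also have "\<dots> \<le> 200 * (length A + 2) * (card (confs n A L) + 2)" by (simp add: algebra_simps)
  finally show ?case using 4(2) by simp
qed

end

lemma set_encode_lessThan: "set_encode {..<n} + 1 = 2 ^ n"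
  unfolding set_encode_def by (induction n) auto

context temporal_instance
begin

text \<open>The entries before \<open>h\<close> are done: the good ones have all their successors in
  the queue, and \<open>output\<close> reports whether one of them is complete. Once
  \<open>h\<close> reaches the end, the queue is closed under the rules of
  \<open>confs\<close>.\<close>

definition search_invariant :: "state \<Rightarrow> conf list \<Rightarrow> bool" where
  "search_invariant s cs \<longleftrightarrow> represents n A L s \<and> queue_of s = map encode_conf cs \<and> distinct cs \<and>
    set cs \<subseteq> confs n A L \<and> (n, 0, {}) \<in> set cs \<and> s ''h'' 0 \<le> length cs \<and>
    (\<forall>i < s ''h'' 0. good n A L (cs ! i) \<longrightarrow> succs A (cs ! i) \<subseteq> set cs) \<and>
    s ''output'' 0 = of_bool (\<exists>i < s ''h'' 0. \<exists>x s. x < n \<and> cs ! i = (x, s, {..<n}))"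

definition body_bound :: nat where
  "body_bound = 1000 * (n + 2) + 200 * (L + 2) * (length A + 1) +
    200 * (length A + 2) * (card (confs n A L) + 2)"

lemma run_search_body:
  assumes inv: "search_invariant s cs" and h: "s ''h'' 0 < length cs"
  shows "run search_body s
    (\<lambda>t s'. t \<le> body_bound \<and> s' ''h'' 0 = Suc (s ''h'' 0) \<and> (\<exists>cs'. search_invariant s' cs'))"
proof -
  let ?rest = "decode_visited ;; compute_reach ;; test_good ;;
    Cond (Equal (Var ''ok'') One) expand Skip ;; Inc ''h''"
  let ?h = "s ''h'' 0" and ?C = "card (confs n A L)"
  obtain x \<sigma> V where c: "cs ! ?h = (x, \<sigma>, V)" by (cases "cs ! ?h")
  have rep: "represents n A L s" and queue: "queue_of s = map encode_conf cs" and dist: "distinct cs"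
    and sub: "set cs \<subseteq> confs n A L" and root: "(n, 0, {}) \<in> set cs"
    and old: "\<And>i. i < ?h \<Longrightarrow> good n A L (cs ! i) \<Longrightarrow> succs A (cs ! i) \<subseteq> set cs"
    and out: "s ''output'' 0 = of_bool (\<exists>i < ?h. \<exists>x s. x < n \<and> cs ! i = (x, s, {..<n}))"
    using inv unfolding search_invariant_def by auto
  have cin: "(x, \<sigma>, V) \<in> confs n A L" using sub nth_mem[OF h] c by auto
  have V: "V \<subseteq> {..<n}" using confs_visited[OF cin] .
  have finV: "finite V" using finite_subset[OF V] by simp
  have xn: "x \<le> n" using confs_bounds[OF cin] by auto
  have "?h < s ''q'' 0" using h length_queue_of[of s] queue by simp
  then have q: "s ''qx'' ?h = x" "s ''qs'' ?h = \<sigma>" "s ''qm'' ?h = set_encode V"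
    using nth_queue_of[of ?h s] h by (auto simp: queue c encode_conf_def)
  let ?full = "x < n \<and> V = {..<n}"
  have full: "x < n \<and> Suc (set_encode V) = 2 ^ n \<longleftrightarrow> ?full"
    using set_encode_lessThan[of n] set_encode_eq[OF finV finite_lessThan[of n]] by auto
  define s1 where "s1 = (if ?full
    then update_cell (update_cell (update_cell s ''x'' 0 x) ''s'' 0 \<sigma>) ''output'' 0 1
    else update_cell (update_cell s ''x'' 0 x) ''s'' 0 \<sigma>)"
  \<comment> \<open>The opening commands cost 29 or 27 steps, depending on whether
    \<open>output\<close> is written; \<open>main\<close> uniformly reserves 100 for them.\<close>
  have start: "run (Set ''x'' (Cell ''qx'' (Var ''h'')) ;;
       Set ''s'' (Cell ''qs'' (Var ''h'')) ;;
       Cond (Conj (Less (Var ''x'') (Var ''n''))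
              (Equal (Plus (Cell ''qm'' (Var ''h'')) One) (Cell ''w'' (Var ''n''))))
         (Set ''output'' One) Skip ;; rest) s Q"
    if "\<And>t0. t0 \<le> 100 \<Longrightarrow> run rest s1 (\<lambda>t. Q (t0 + t))" for rest Q
  proof (cases ?full)
    case True
    with full have "x < n" "Suc (set_encode V) = 2 ^ n" by auto
    with True show ?thesis
      using that[of 29] by (simp add: s1_def q representsD[OF rep] eval_nat_numeral add.commute)
  next
    case False
    with full have "\<not> (x < n \<and> Suc (set_encode V) = 2 ^ n)" by auto
    with False show ?thesis
      using that[of 27]
      by (cases "x < n") (simp_all add: s1_def q representsD[OF rep] eval_nat_numeral add.commute)
  qed
  have ag1: "agree {''x'', ''s'', ''output''} s s1" by (simp add: s1_def)
  have rep1: "represents n A L s1" by (rule represents_agree[OF rep ag1]) simp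
  have s1: "s1 ''x'' 0 = x" "s1 ''s'' 0 = \<sigma>" "s1 ''h'' 0 = ?h" "s1 ''qm'' (s1 ''h'' 0) = set_encode V"
    using q by (simp_all add: s1_def)
  have out1: "s1 ''output'' 0 = of_bool (\<exists>i < Suc ?h. \<exists>x s. x < n \<and> cs ! i = (x, s, {..<n}))"
    using out c by (auto simp: s1_def less_Suc_eq)
  have queue1: "queue_of s1 = map encode_conf cs"
    using queue by (simp add: s1_def queue_of_def)
  have w1: "s1 ''w'' i = 2 ^ i" if "i < n" for i using representsD(4)[OF rep1] that by simp
  have main: "run ?rest s1 (\<lambda>t s'. 100 + t \<le> body_bound \<and> s' ''h'' 0 = Suc ?h \<and> (\<exists>cs'. search_invariant s' cs'))"
    unfolding run_Seq
  proof (rule run_mono[OF run_decode_visited[OF representsD(1)[OF rep1] w1 V s1(4)]], assumption, goal_cases)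
    case (1 t2 s2)
    have ag2: "agree {''r'', ''i'', ''vis''} s1 s2" and t2: "t2 \<le> 100 * (n + 1)"
      and vis2: "\<And>i. i < n \<Longrightarrow> s2 ''vis'' i = of_bool (i \<in> V)" using 1 by auto
    have rep2: "represents n A L s2" by (rule represents_agree[OF rep1 ag2]) simp
    have s2: "s2 ''x'' 0 = x" "s2 ''s'' 0 = \<sigma>" "s2 ''h'' 0 = ?h"
      using agreeD[OF ag2] s1 by simp_all
    show ?case
    proof (rule run_mono, rule run_compute_reach[OF rep2], erule arc_endpoints, goal_cases)
      case 1
      then show ?case using s2 xn by simp
    next
      case (2 t3 s3)
      have ag3: "agree {''re'', ''i'', ''j''} s2 s3"
        and t3: "t3 \<le> 200 * (n + 2) + 200 * (L + 2) * (length A + 1)"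
        and re3: "\<And>i. i \<le> n \<Longrightarrow> s3 ''re'' i = 1 \<longleftrightarrow> i \<in> reach A x \<sigma> (Suc L)" using 2 s2 by auto
      have rep3: "represents n A L s3" by (rule represents_agree[OF rep2 ag3]) simp
      have vis3: "s3 ''vis'' = s2 ''vis''" using agreeD[OF ag3] by simp
      show ?case
      proof (rule run_mono[OF run_test_good[of s3 n, OF representsD(1)[OF rep3]]], goal_cases)
        case (1 t4 s4)
        have ag4: "agree {''ok'', ''i''} s3 s4" and t4: "t4 \<le> 100 * (n + 1)" using 1 by auto
        have rep4: "represents n A L s4" by (rule represents_agree[OF rep3 ag4]) simp
        have "s4 ''ok'' 0 = 1 \<longleftrightarrow> (\<forall>i<n. s3 ''vis'' i = 0 \<longrightarrow> s3 ''re'' i = 1)" using 1 by simp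
        also have "\<dots> \<longleftrightarrow> good n A L (x, \<sigma>, V)"
          unfolding good_def using vis2 re3 by (auto simp: vis3 simp del: reach.simps)
        finally have ok: "s4 ''ok'' 0 = 1 \<longleftrightarrow> good n A L (x, \<sigma>, V)" .
        have ag14: "agree {''r'', ''i'', ''vis'', ''re'', ''j'', ''ok''} s1 s4"
          using ag2 ag3 ag4 unfolding agree_def by simp
        note e4 = agreeD[OF ag14]
        have s4: "s4 ''x'' 0 = x" "s4 ''s'' 0 = \<sigma>" "s4 ''h'' 0 = ?h"
          "s4 ''output'' 0 = s1 ''output'' 0"
          using e4 s1 by simp_all
        have queue4: "queue_of s4 = map encode_conf cs"
          using queue1 by (simp add: queue_of_def e4)
        have vis4: "s4 ''vis'' i = of_bool (i \<in> V)" if "i < n" for i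
          using agreeD[OF ag4, of "''vis''"] vis3 vis2[OF that] by simp
        \<comment> \<open>Common to both outcomes of the test; a failing configuration appends
          nothing, so there \<open>r\<close> is empty and the last premise holds vacuously.\<close>
        have fin: "search_invariant (update_cell s5 ''h'' 0 (Suc ?h)) (cs @ r)"
          if ag5: "agree {''j'', ''y'', ''ys'', ''ym'', ''k'', ''found'', ''qx'', ''qs'', ''qm'', ''q''} s4 s5"
            and r: "queue_of s5 = map encode_conf (cs @ r)" "distinct (cs @ r)" "set (cs @ r) \<subseteq> confs n A L"
            "good n A L (x, \<sigma>, V) \<Longrightarrow> succs A (x, \<sigma>, V) \<subseteq> set (cs @ r)" for s5 r
        proof -
          have "agree {''h'', ''j'', ''y'', ''ys'', ''ym'', ''k'', ''found'', ''qx'', ''qs'', ''qm'', ''q''} s4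
              (update_cell s5 ''h'' 0 (Suc ?h))"
            using ag5 unfolding agree_def by simp
          then have rep5: "represents n A L (update_cell s5 ''h'' 0 (Suc ?h))"
            by (rule represents_agree[OF rep4]) simp
          have queue5: "queue_of (update_cell s5 ''h'' 0 (Suc ?h)) = queue_of s5"
            by (simp add: queue_of_def)
          have nth: "(cs @ r) ! i = cs ! i" if "i < Suc ?h" for i
            using that h by (simp add: nth_append)
          have out5: "s5 ''output'' 0 = of_bool (\<exists>i < Suc ?h. \<exists>x s. x < n \<and> (cs @ r) ! i = (x, s, {..<n}))"
            using agreeD[OF ag5, of "''output''"] s4(4) out1 nth by simp
          have new: "succs A ((cs @ r) ! i) \<subseteq> set (cs @ r)"
            if "i < Suc ?h" "good n A L ((cs @ r) ! i)" for i
          proof (cases "i = ?h")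
            case True
            then show ?thesis using that r(4) nth[OF that(1)] c by simp
          next
            case False
            then have "i < ?h" using that(1) by simp
            from old[OF this] show ?thesis using that(2) nth[OF that(1)] by auto
          qed
          show ?thesis
            unfolding search_invariant_def queue5
            using rep5 r root out5 new h by simp
        qed
        show ?case
        proof (cases "good n A L (x, \<sigma>, V)")
          case True
          have head: "s4 ''h'' 0 < length cs" "cs ! s4 ''h'' 0 = (s4 ''x'' 0, s4 ''s'' 0, V)"
            using s4 h c by simp_all
          have sc: "succs A (s4 ''x'' 0, s4 ''s'' 0, V) \<subseteq> confs n A L"
            using confs.step[OF cin True] s4 by auto
          have b: "bval (Equal (Var ''ok'') One) s4" using True ok by simp
          show ?thesis
            unfolding run_Cond if_P[OF b]
          proof (rule run_mono[OF run_expand[OF rep4 queue4 dist sub head vis4 sc]], assumption, goal_cases)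
            case (1 t5 s5)
            then obtain r where r: "queue_of s5 = map encode_conf (cs @ r)" "distinct (cs @ r)"
              "set (cs @ r) = set cs \<union> succs A (x, \<sigma>, V)" using s4 by auto
            have ag5: "agree {''j'', ''y'', ''ys'', ''ym'', ''k'', ''found'', ''qx'', ''qs'', ''qm'', ''q''} s4 s5"
              using 1 by (elim conjE)
            have "search_invariant (update_cell s5 ''h'' 0 (Suc ?h)) (cs @ r)"
              by (rule fin[OF ag5 r(1,2)]) (use r(3) sub sc s4 in auto)
            moreover have "s5 ''h'' 0 = ?h" using agreeD[OF ag5, of "''h''"] s4(3) by simp
            moreover have "t5 \<le> 200 * (length A + 2) * (?C + 2)" using 1 by (elim conjE)
            then have "100 + (t2 + (t3 + (t4 + (1 + bcost (Equal (Var ''ok'') One) + t5 + 6)))) \<le> body_bound"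
              using t2 t3 t4 unfolding body_bound_def by simp
            ultimately show ?case by (auto simp: eval_nat_numeral add.commute)
          qed
        next
          case False
          then have b: "\<not> bval (Equal (Var ''ok'') One) s4" using ok by simp
          have "search_invariant (update_cell s4 ''h'' 0 (Suc ?h)) (cs @ [])"
            by (rule fin) (use queue4 dist sub False in auto)
          moreover have "100 + (t2 + (t3 + (t4 + 20))) \<le> body_bound"
            using t2 t3 t4 unfolding body_bound_def by simp
          ultimately show ?thesis
            unfolding run_Cond if_not_P[OF b] using s4(3) by auto
        qed
      qed
    qed
  qed
  show ?thesis
    unfolding search_body_def by (rule start, rule run_mono[OF main]) auto
qed

text \<open>The guard refers to a queue that grows, so termination is measured by
  \<open>card (confs n A L) - h\<close>: distinct configurations cannot outnumber
  \<open>confs n A L\<close>. At the end, rule induction over \<open>confs\<close> shows that none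
  is missing.\<close>

lemma run_search:
  assumes rep: "represents n A L s" and out: "s ''output'' 0 = 0"
  shows "run search s (\<lambda>t s'. t \<le> (card (confs n A L) + 2) * (body_bound + 100) \<and>
    result s' = (if has_temporal_hamiltonian_path G then 1 else 0))"
proof -
  let ?C = "card (confs n A L)"
  let ?J = "\<lambda>s. \<exists>cs. search_invariant s cs"
  define s1 where "s1 = s(''qx'' := (s ''qx'')(0 := n), ''qs'' := (s ''qs'')(0 := 0),
    ''qm'' := (s ''qm'')(0 := 0), ''h'' := (s ''h'')(0 := 0), ''q'' := (s ''q'')(0 := 1))"
  have "agree {''qx'', ''qs'', ''qm'', ''h'', ''q''} s s1" by (simp add: s1_def)
  then have rep1: "represents n A L s1" by (rule represents_agree[OF rep]) simp
  have "search_invariant s1 [(n, 0, {})]"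
    unfolding search_invariant_def using rep1 out
    by (auto simp: s1_def queue_of_def encode_conf_def confs.root)
  then have J1: "?J s1" ..
  have len: "s ''h'' 0 \<le> ?C \<and> s ''q'' 0 = length cs \<and> length cs \<le> ?C" if "search_invariant s cs" for s cs
  proof -
    have "length cs \<le> ?C" using length_queue_le that unfolding search_invariant_def by blast
    moreover have "s ''q'' 0 = length cs"
      using length_queue_of[of s] that unfolding search_invariant_def by simp
    moreover have "s ''h'' 0 \<le> length cs" using that unfolding search_invariant_def by simp
    ultimately show ?thesis by simp
  qed
  have init: "run search s Q \<longleftrightarrow>
      run (While (Less (Var ''h'') (Var ''q'')) search_body) s1 (\<lambda>t. Q (16 + t))" for Q
    by (simp add: search_def s1_def representsD(1)[OF rep] eval_nat_numeral)
  show ?thesis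
    unfolding init
  proof (rule run_mono[OF run_While[where I = ?J
      and K = body_bound and m = "\<lambda>s. ?C - s ''h'' 0"]], rule J1, goal_cases)
    case (1 s)
    then obtain cs where cs: "search_invariant s cs" by auto
    have h: "s ''h'' 0 < length cs" using 1(2) len[OF cs] by simp
    show ?case
      by (rule run_mono[OF run_search_body[OF cs h]]) (use len[OF cs] h in auto)
  next
    case (2 t s')
    then obtain cs where cs: "search_invariant s' cs" by auto
    have h: "s' ''h'' 0 = length cs" using 2 len[OF cs] cs by (auto simp: search_invariant_def)
    have closed: "succs A (cs ! i) \<subseteq> set cs" if "i < length cs" "good n A L (cs ! i)" for i
      using cs h that unfolding search_invariant_def by simp
    have "c \<in> set cs" if "c \<in> confs n A L" for c
      using that
    proof induction
      case root then show ?case using cs by (simp add: search_invariant_def)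
    next
      case (step c c')
      from step(4) obtain i where "i < length cs" "cs ! i = c" by (auto simp: in_set_conv_nth)
      then show ?case using closed[of i] step(2,3) by auto
    qed
    then have set: "set cs = confs n A L" using cs by (auto simp: search_invariant_def)
    have "(\<exists>i<length cs. \<exists>x s. x < n \<and> cs ! i = (x, s, {..<n})) \<longleftrightarrow> has_temporal_hamiltonian_path G"
      unfolding has_temporal_hamiltonian_path_iff set[symmetric] in_set_conv_nth by blast
    then have "result s' = (if has_temporal_hamiltonian_path G then 1 else 0)"
      using cs h by (simp add: search_invariant_def result_def)
    moreover have "s1 ''h'' 0 = 0" by (simp add: s1_def)
    ultimately show ?case using 2 by (simp add: algebra_simps)
  qed
qed

end

section \<open>Reading the input\<close>

type_synonym edge = "nat \<times> nat \<times> nat list"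

definition edge_code :: "edge \<Rightarrow> nat list" where
  "edge_code = (\<lambda>(u, v, ts). u # v # length ts # ts)"

definition edge_arcs :: "edge \<Rightarrow> arc list" where
  "edge_arcs = (\<lambda>(u, v, ts). concat (map (\<lambda>t. [(u, v, t), (v, u, t)]) ts))"

definition source_arcs :: "nat \<Rightarrow> arc list" where
  "source_arcs n = map (\<lambda>x. (n, x, 0)) [0..<n]"

text \<open>A running maximum with default 0. If all arcs are source arcs it forces
  \<open>l = 0\<close>; otherwise it becomes the lifetime.\<close>

definition is_max_time :: "arc list \<Rightarrow> nat \<Rightarrow> bool" where
  "is_max_time A l \<longleftrightarrow> (\<forall>(a, b, t)\<in>set A. t \<le> l) \<and> (l = 0 \<or> (\<exists>a b. (a, b, l) \<in> set A))"

lemma is_max_time_append2: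
  "is_max_time A l \<Longrightarrow> is_max_time (A @ [(u, v, t), (v, u, t)]) (if l < t then t else l)"
  by (auto simp: is_max_time_def split: prod.splits)

definition add_arc :: "state \<Rightarrow> arc \<Rightarrow> state" where
  "add_arc s = (\<lambda>(a, b, c). let m = s ''m'' 0 in s(''u'' := (s ''u'')(m := a), ''v'' := (s ''v'')(m := b),
    ''t'' := (s ''t'')(m := c), ''m'' := (s ''m'')(0 := Suc m)))"

lemma add_arc_other: "z \<notin> {''u'', ''v'', ''t'', ''m''} \<Longrightarrow> add_arc s a z = s z"
  by (cases a) (simp add: add_arc_def Let_def)

lemma arcs_of_add_arc: "arcs_of (add_arc s a) = arcs_of s @ [a]"
  by (cases a) (simp add: arcs_of_def add_arc_def Let_def)

lemma arcs_of_update: "z \<notin> {''u'', ''v'', ''t'', ''m''} \<Longrightarrow> arcs_of (s(z := f)) = arcs_of s"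
  by (auto simp: arcs_of_def)

text \<open>\<open>b\<close> is evaluated after \<open>u\<close> has been written, \<open>c\<close>
  after \<open>u\<close> and \<open>v\<close>; the assumptions rule out interference. Apart from its
  arguments, the code costs 15 steps.\<close>

lemma run_push_arc:
  assumes "\<And>f. aval b (s(''u'' := f)) = aval b s" "\<And>f g. aval c (s(''u'' := f, ''v'' := g)) = aval c s"
  shows "run (push_arc a b c) s Q \<longleftrightarrow>
    Q (15 + acost a + acost b + acost c) (add_arc s (aval a s, aval b s, aval c s))"
  by (simp add: push_arc_def add_arc_def Let_def assms eval_nat_numeral add.assoc add.left_commute)

lemma run_read_edge:
  fixes s :: state
  defines "X \<equiv> {''a'', ''b'', ''c'', ''p'', ''j'', ''u'', ''v'', ''t'', ''m'', ''L''}"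
  assumes input: "\<And>j. j < 3 + length ts \<Longrightarrow> s ''input'' (s ''p'' 0 + j) = edge_code (u, v, ts) ! j"
    and D: "length ts \<le> D"
    and max: "is_max_time (arcs_of s) (s ''L'' 0)"
  shows "run read_edge s (\<lambda>t s'. t \<le> 200 * (D + 2) \<and> agree X s s' \<and>
    s' ''p'' 0 = s ''p'' 0 + 3 + length ts \<and>
    arcs_of s' = arcs_of s @ edge_arcs (u, v, ts) \<and> is_max_time (arcs_of s') (s' ''L'' 0))"
proof -
  let ?p = "s ''p'' 0"
  define s1 where "s1 = s(''a'' := (s ''a'')(0 := u), ''b'' := (s ''b'')(0 := v),
    ''c'' := (s ''c'')(0 := length ts), ''p'' := (s ''p'')(0 := ?p + 3))"
  have "s ''input'' ?p = u" "s ''input'' (Suc ?p) = v" "s ''input'' (Suc (Suc ?p)) = length ts"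
    using input[of 0] input[of 1] input[of 2] by (simp_all add: edge_code_def)
  then have start: "run read_edge s Q \<longleftrightarrow>
      run (For ''j'' (Var ''c'')
      (push_arc (Var ''a'') (Var ''b'') (Cell ''input'' (Var ''p'')) ;;
       push_arc (Var ''b'') (Var ''a'') (Cell ''input'' (Var ''p'')) ;;
       Cond (Less (Var ''L'') (Cell ''input'' (Var ''p'')))
         (Set ''L'' (Cell ''input'' (Var ''p''))) Skip ;;
       Inc ''p'')) s1 (\<lambda>t. Q (25 + t))" for Q
    unfolding read_edge_def by (simp add: s1_def eval_nat_numeral)
  show ?thesis
    unfolding start
  proof (rule run_For[where N = "length ts" and K = 110 and I = "\<lambda>k s'. agree X s s' \<and>
      s' ''p'' 0 = ?p + 3 + k \<and> s' ''a'' 0 = u \<and> s' ''b'' 0 = v \<and> s' ''c'' 0 = length ts \<and>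
      arcs_of s' = arcs_of s @ edge_arcs (u, v, take k ts) \<and> is_max_time (arcs_of s') (s' ''L'' 0)"],
      goal_cases)
    case 1
    have "arcs_of (update_cell s1 ''j'' 0 0) = arcs_of s" by (simp add: arcs_of_def s1_def)
    then show ?case using max by (simp add: s1_def X_def edge_arcs_def)
  next
    case (2 k s')
    then show ?case by simp
  next
    case (3 k s')
    have ag: "agree X s s'" and p: "s' ''p'' 0 = ?p + 3 + k" and
      ab: "s' ''a'' 0 = u" "s' ''b'' 0 = v" and c: "s' ''c'' 0 = length ts" and
      arcs: "arcs_of s' = arcs_of s @ edge_arcs (u, v, take k ts)" and
      max': "is_max_time (arcs_of s') (s' ''L'' 0)"
      using 3(1) by auto
    have "s' ''input'' = s ''input''" using ag by (auto simp: agree_def X_def)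
    then have in_t: "s' ''input'' (?p + 3 + k) = ts ! k"
      using input[of "3 + k"] 3(3) by (simp add: edge_code_def add.assoc eval_nat_numeral)
    let ?m = "s' ''m'' 0" and ?t = "ts ! k"
    let ?l = "if s' ''L'' 0 < ?t then ?t else s' ''L'' 0"
    define s2 where "s2 = add_arc (add_arc s' (u, v, ?t)) (v, u, ?t)"
    define s3 where "s3 = (if s' ''L'' 0 < ?t then update_cell s2 ''L'' 0 ?t else s2)"
    have s2: "s2 z = s' z" if "z \<notin> {''u'', ''v'', ''t'', ''m''}" for z
      using that unfolding s2_def by (simp add: add_arc_other)
    have s3: "s3 z = s' z" if "z \<notin> {''u'', ''v'', ''t'', ''m'', ''L''}" for z
      using that s2 by (simp add: s3_def)
    have arcs3: "arcs_of s3 = arcs_of s' @ [(u, v, ?t), (v, u, ?t)]"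
      by (simp add: s3_def s2_def arcs_of_update arcs_of_add_arc)
    have L3: "s3 ''L'' 0 = ?l" by (simp add: s3_def s2)
    let ?s4 = "update_cell (update_cell s3 ''p'' 0 (?p + 4 + k)) ''j'' 0 (Suc k)"
    have "agree X s ?s4"
      using ag unfolding agree_def by (simp add: X_def s3)
    moreover have "arcs_of ?s4 = arcs_of s' @ [(u, v, ?t), (v, u, ?t)]"
      by (simp add: arcs_of_update arcs3)
    moreover have "edge_arcs (u, v, take (Suc k) ts) = edge_arcs (u, v, take k ts) @ [(u, v, ?t), (v, u, ?t)]"
      using 3(3) by (simp add: edge_arcs_def take_Suc_conv_app_nth)
    moreover have "?s4 ''L'' 0 = ?l" using L3 by simp
    moreover have "?s4 ''a'' 0 = u" "?s4 ''b'' 0 = v" "?s4 ''c'' 0 = length ts"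
      using ab c by (simp_all add: s3)
    ultimately have fin: "agree X s ?s4 \<and> ?s4 ''p'' 0 = ?p + 3 + Suc k \<and> ?s4 ''a'' 0 = u \<and> ?s4 ''b'' 0 = v \<and>
      ?s4 ''c'' 0 = length ts \<and> arcs_of ?s4 = arcs_of s @ edge_arcs (u, v, take (Suc k) ts) \<and>
      is_max_time (arcs_of ?s4) (?s4 ''L'' 0)"
      using arcs is_max_time_append2[OF max'] by simp
    have j: "s3 ''j'' 0 = k" using 3(2) by (simp add: s3)
    let ?body = "push_arc (Var ''a'') (Var ''b'') (Cell ''input'' (Var ''p'')) ;;
       push_arc (Var ''b'') (Var ''a'') (Cell ''input'' (Var ''p'')) ;;
       Cond (Less (Var ''L'') (Cell ''input'' (Var ''p'')))
         (Set ''L'' (Cell ''input'' (Var ''p''))) Skip ;;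
       Inc ''p''"
    have in_t': "s' ''input'' (s' ''p'' 0) = ?t" using in_t p by simp
    \<comment> \<open>The branches differ in cost, 62 against 58, but both end in \<open>s3\<close>
      with \<open>p\<close> advanced; quantifying over the postcondition yields one equation for
      both.\<close>
    have "\<exists>c\<le>62. \<forall>Q. run ?body s' Q \<longleftrightarrow> Q c (update_cell s3 ''p'' 0 (Suc (s' ''p'' 0)))"
    proof (cases "s' ''L'' 0 < ?t")
      case True
      then show ?thesis
        by (intro exI[of _ 62])
          (simp add: run_push_arc add_arc_other ab in_t' s3_def s2_def[symmetric] s2)
    next
      case False
      then show ?thesis
        by (intro exI[of _ 58])
          (simp add: run_push_arc add_arc_other ab in_t' s3_def s2_def[symmetric] s2)
    qed
    moreover have "Suc (s' ''p'' 0) = ?p + 4 + k" using p by simp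
    ultimately have "\<exists>c\<le>62. \<forall>Q. run ?body s' Q \<longleftrightarrow> Q c (update_cell s3 ''p'' 0 (?p + 4 + k))"
      by (simp only:)
    then show ?case
    proof (elim exE conjE)
      fix c :: nat assume c: "c \<le> 62"
        and body: "\<forall>Q. run ?body s' Q \<longleftrightarrow> Q c (update_cell s3 ''p'' 0 (?p + 4 + k))"
      show ?thesis
        unfolding body[rule_format]
      proof (rule conjI[OF _ conjI[OF _ fin]])
        show "c \<le> 110" using c by simp
        show "update_cell s3 ''p'' 0 (?p + 4 + k) ''j'' 0 = k" using j by simp
      qed
    qed
  next
    case (4 t s')
    have "t \<le> 3 + (length ts + 1) * 122" using 4(1) by simp
    also have "\<dots> \<le> 3 + (D + 1) * 122" using D by simp
    finally have "25 + t \<le> 200 * (D + 2)" by simp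
    then show ?case using 4(2) unfolding take_all[OF order_refl] by (intro conjI) (elim conjE, assumption)+
  qed
qed

lemma run_read_instance:
  assumes xs: "xs = n # length es # concat (map edge_code es)"
    and D: "\<And>u v ts. (u, v, ts) \<in> set es \<Longrightarrow> length ts \<le> D"
  defines "A \<equiv> source_arcs n @ concat (map edge_arcs es)"
  shows "run read_instance (input_state xs) (\<lambda>t s'.
    t \<le> 500 * (n + 1) + 500 * (length es + 1) * (D + 2) \<and>
    represents n A (s' ''L'' 0) s' \<and> is_max_time A (s' ''L'' 0) \<and> s' ''output'' 0 = 0)"
proof -
  define s0 where "s0 = input_state xs"
  have inp: "s0 ''input'' i = xs ! i" if "i < length xs" for i using that by (simp add: s0_def input_state_def)
  have zero: "s0 z i = 0" if "z \<noteq> ''input''" for z i using that by (simp add: s0_def input_state_def)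
  have in01: "s0 ''input'' 0 = n" "s0 ''input'' (Suc 0) = length es" using inp[of 0] inp[of 1] by (simp_all add: xs)
  define s1 where "s1 = s0(''n'' := (s0 ''n'')(0 := n), ''w'' := (s0 ''w'')(0 := 1))"
  have start: "run read_instance s0 Q \<longleftrightarrow> run
    (For ''i'' (Var ''n'')
      (Assign ''w'' (Plus (Var ''i'') One) (Plus (Cell ''w'' (Var ''i'')) (Cell ''w'' (Var ''i'')))) ;;
    For ''i'' (Var ''n'') (push_arc (Var ''n'') (Var ''i'') (Num 0)) ;;
    Set ''p'' (Num 2) ;;
    For ''i'' (Cell ''input'' One) read_edge) s1 (\<lambda>t. Q (7 + t))" for Q
    unfolding read_instance_def by (simp add: s1_def in01 eval_nat_numeral)
  show ?thesis
    unfolding s0_def[symmetric] start run_Seq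
  proof (rule run_For[where N = n and K = 40 and I = "\<lambda>k s. agree {''n'', ''w'', ''i''} s0 s \<and> s ''n'' 0 = n \<and>
      (\<forall>i\<le>k. s ''w'' i = 2 ^ i)"], goal_cases)
    case 1
    show ?case by (simp add: s1_def)
  next
    case (2 k s)
    then show ?case by simp
  next
    case (3 k s)
    then show ?case by (auto simp: le_Suc_eq)
  next
    case (4 t2 s2)
    have e2: "s2 z = s0 z" if "z \<notin> {''n'', ''w'', ''i''}" for z using 4(2) that agreeD by blast
    have n2: "s2 ''n'' 0 = n" and w2: "\<forall>i\<le>n. s2 ''w'' i = 2 ^ i" using 4(2) by auto
    show ?case
    proof (rule run_For[where N = n and K = 40 and I = "\<lambda>k s. agree {''i'', ''u'', ''v'', ''t'', ''m''} s2 s \<and>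
      arcs_of s = map (\<lambda>x. (n, x, 0)) [0..<k]"], goal_cases)
      case 1
      show ?case by (simp add: arcs_of_def e2 zero)
    next
      case (2 k s)
      then have "s ''n'' = s2 ''n''" by (auto simp: agree_def)
      then show ?case using n2 by simp
    next
      case (3 k s)
      then have n3: "s ''n'' 0 = n" using n2 by (auto simp: agree_def)
      have arcs3: "arcs_of s = map (\<lambda>x. (n, x, 0)) [0..<k]" using 3(1) by (elim conjE)
      define s' where "s' = add_arc s (n, k, 0)"
      have "run (push_arc (Var ''n'') (Var ''i'') (Num 0)) s Q \<longleftrightarrow> Q 20 s'" for Q
        by (simp add: run_push_arc s'_def n3 3(2))
      moreover have "arcs_of (update_cell s' ''i'' 0 (Suc k)) = arcs_of s @ [(n, k, 0)]"
        by (simp add: arcs_of_update arcs_of_add_arc s'_def)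
      moreover have "agree {''i'', ''u'', ''v'', ''t'', ''m''} s2 (update_cell s' ''i'' 0 (Suc k))"
        using 3(1) unfolding agree_def by (simp add: s'_def add_arc_other)
      moreover have "s' ''i'' 0 = k" using 3(2) by (simp add: s'_def add_arc_other)
      ultimately show ?case using arcs3 by simp
    next
      case (4 t3 s3)
      have ag3: "agree {''i'', ''u'', ''v'', ''t'', ''m''} s2 s3" using 4(2) by (elim conjE)
      have arcs3: "arcs_of s3 = source_arcs n" using 4(2) unfolding source_arcs_def by (elim conjE)
      have in3: "s3 ''input'' = s0 ''input''" using agreeD[OF ag3] e2 by simp
      let ?Y = "{''i'', ''a'', ''b'', ''c'', ''p'', ''j'', ''u'', ''v'', ''t'', ''m'', ''L''}"
      let ?pos = "\<lambda>k. 2 + length (concat (map edge_code (take k es)))"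
      show ?case
        unfolding run_Assign
      proof (rule run_For[where N = "length es" and K = "200 * (D + 2)" and I = "\<lambda>k s. agree ?Y s3 s \<and>
          s ''p'' 0 = ?pos k \<and> arcs_of s = source_arcs n @ concat (map edge_arcs (take k es)) \<and>
          is_max_time (arcs_of s) (s ''L'' 0)"], goal_cases)
        case 1
        have "s3 ''L'' 0 = 0" using agreeD[OF ag3] e2 zero by simp
        moreover have "arcs_of (update_cell (update_cell s3 ''p'' (aval (Num 0) s3) (aval (Num 2) s3)) ''i'' 0 0) = source_arcs n"
          using arcs3 by (simp add: arcs_of_def)
        ultimately show ?case by (auto simp: is_max_time_def source_arcs_def)
      next
        case (2 k s)
        then have "s ''input'' = s3 ''input''" by (auto simp: agree_def)
        then show ?case using in3 in01 by simp
      next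
        case (3 k s)
        have ag: "agree ?Y s3 s" and p: "s ''p'' 0 = ?pos k" and
          arcs: "arcs_of s = source_arcs n @ concat (map edge_arcs (take k es))" and
          max: "is_max_time (arcs_of s) (s ''L'' 0)" using 3(1) by auto
        obtain u v ts where e: "es ! k = (u, v, ts)" by (cases "es ! k")
        have split: "es = take k es @ (u, v, ts) # drop (Suc k) es"
          using id_take_nth_drop[OF 3(3)] e by simp
        \<comment> \<open>The input is split around the code of edge \<open>k\<close>, which begins
          at \<open>?pos k\<close>; the 2 in \<open>?pos\<close> counts the two header
          numbers.\<close>
        have xs': "xs = [n, length es] @ concat (map edge_code (take k es)) @ edge_code (u, v, ts) @
          concat (map edge_code (drop (Suc k) es))"
          unfolding xs by (subst (2) split) simp
        have len: "length (edge_code (u, v, ts)) = 3 + length ts" by (simp add: edge_code_def)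
        have "s ''input'' = s0 ''input''" using ag in3 by (auto simp: agree_def)
        moreover have "s0 ''input'' (?pos k + j) = edge_code (u, v, ts) ! j" if "j < 3 + length ts" for j
        proof -
          have "?pos k + j < length xs" using that len by (subst xs') simp
          then have "s0 ''input'' (?pos k + j) = xs ! (?pos k + j)" by (rule inp)
          also have "\<dots> = edge_code (u, v, ts) ! j" using that len by (subst xs') (simp add: nth_append)
          finally show ?thesis .
        qed
        ultimately have input: "s ''input'' (s ''p'' 0 + j) = edge_code (u, v, ts) ! j" if "j < 3 + length ts" for j
          using that p by simp
        have "(u, v, ts) \<in> set es" using 3(3) e nth_mem by metis
        then have lts: "length ts \<le> D" by (rule D)
        have take: "take (Suc k) es = take k es @ [(u, v, ts)]" using 3(3) e by (simp add: take_Suc_conv_app_nth)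
        show ?case
        proof (rule run_mono[OF run_read_edge[OF input lts max]], assumption, goal_cases)
          case (1 t s')
          have ag': "agree ?Y s3 (update_cell s' ''i'' 0 (Suc k))"
            using ag 1 unfolding agree_def by simp
          have "s' ''i'' = s ''i''" using 1 by (auto simp: agree_def)
          moreover have "arcs_of (update_cell s' ''i'' 0 (Suc k)) = arcs_of s'" by (simp add: arcs_of_def)
          moreover have "s' ''p'' 0 = s ''p'' 0 + 3 + length ts" "t \<le> 200 * (D + 2)"
            "arcs_of s' = arcs_of s @ edge_arcs (u, v, ts)" "is_max_time (arcs_of s') (s' ''L'' 0)"
            using 1 by auto
          ultimately show ?case using 3(2) ag' arcs p len unfolding take by simp
        qed
      next
        case (4 t4 s4)
        have ag4: "agree ?Y s3 s4" using 4(2) by (elim conjE)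
        have "s4 ''n'' 0 = n" "s4 ''w'' = s2 ''w''" using agreeD[OF ag4] agreeD[OF ag3] n2 by simp_all
        moreover have arcs4: "arcs_of s4 = A" using 4(2) unfolding A_def by simp
        ultimately have "represents n A (s4 ''L'' 0) s4" using w2 by (simp add: represents_def)
        moreover have "is_max_time A (s4 ''L'' 0)" using 4(2) unfolding arcs4 by (elim conjE)
        moreover have "s4 ''output'' 0 = 0" using agreeD[OF ag4] agreeD[OF ag3] e2 zero by simp
        moreover have "t2 \<le> 3 + (n + 1) * 52" "t3 \<le> 3 + (n + 1) * 52"
          using \<open>t2 \<le> _\<close> \<open>t3 \<le> _\<close> by simp_all
        moreover have "t4 \<le> 3 + (length es + 1) * (12 + 200 * (D + 2))" using 4(1) by simp
        then have "t4 \<le> 3 + (length es + 1) * (212 * (D + 2))"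
          by (rule order_trans) (simp add: algebra_simps)
        ultimately show ?case by (simp add: algebra_simps)
      qed
    qed
  qed
qed

section \<open>The running time\<close>

text \<open>As \<open>2 \<le> N\<close>, a sum can be paid for with one more factor
  \<open>N\<close>, so all estimates keep the shape \<open>N ^ i * P\<close> and no constants
  accumulate.\<close>

lemma power_bound_add:
  fixes N :: nat
  assumes "2 \<le> N" "x \<le> N ^ i * P" "y \<le> N ^ i * P"
  shows "x + y \<le> N ^ Suc i * P"
proof -
  have "x + y \<le> 2 * (N ^ i * P)" using assms(2,3) by simp
  also have "\<dots> \<le> N * (N ^ i * P)" using assms(1) by (rule mult_le_mono1)
  finally show ?thesis by (simp add: mult.assoc)
qed

lemma power_bound_mult:
  fixes N :: nat
  assumes "x \<le> N ^ i * P" "y \<le> N ^ j * Q"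
  shows "x * y \<le> N ^ (i + j) * (P * Q)"
  using mult_le_mono[OF assms] by (simp add: power_add ac_simps)

lemma power_bound_weaken:
  fixes N :: nat
  assumes "2 \<le> N" "x \<le> N ^ i * P" "i \<le> j" "P \<le> Q"
  shows "x \<le> N ^ j * Q"
proof -
  have "N ^ i \<le> N ^ j" using assms(1,3) by (intro power_increasing) auto
  then have "N ^ i * P \<le> N ^ j * Q" using assms(4) by (rule mult_le_mono)
  then show ?thesis using assms(2) by simp
qed

text \<open>\<open>E\<close> counts edges, \<open>D\<close> bounds the labels of an edge,
  \<open>M\<close> counts arcs and \<open>C\<close> configurations. \<open>C\<close> is linear in
  \<open>P\<close> and enters twice, as number of iterations and as queue length, which gives
  \<open>P ^ 2\<close>. The dominant product has exponent 11 + 28, and the last sum adds 1.\<close>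

lemma time_bound:
  fixes N P n L E D M C :: nat
  assumes N: "2 \<le> N" and P: "1 \<le> P" and n: "n \<le> N" and L: "L \<le> N" and E: "E \<le> N * N"
    and D: "D \<le> N" and M: "M \<le> n + 2 * E * D" and C: "C \<le> 1 + (1 + n * Suc L * P) * M"
  shows "500 * (n + 1) + 500 * (E + 1) * (D + 2) +
    (C + 2) * (1000 * (n + 2) + 200 * (L + 2) * (M + 1) + 200 * (M + 2) * (C + 2) + 100)
    \<le> N ^ 40 * P ^ 2"
proof -
  note add = power_bound_add[OF N] and weaken = power_bound_weaken[OF N]
  have const: "c \<le> N ^ k * 1" if "c \<le> 2 ^ k" for c k :: nat
    using that power_mono[OF N, of k] by simp
  have PP: "P \<le> P * P" "1 \<le> P * P" using P by simp_all
  have c1: "1 \<le> N ^ 1 * 1" "2 \<le> N ^ 1 * 1" "100 \<le> N ^ 7 * 1" "200 \<le> N ^ 8 * 1" "500 \<le> N ^ 9 * 1"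
    "1000 \<le> N ^ 10 * 1"
    by (rule const; simp)+
  have v: "n \<le> N ^ 1 * 1" "L \<le> N ^ 1 * 1" "D \<le> N ^ 1 * 1" "E \<le> N ^ 2 * 1"
    using n L D E by (simp_all add: power2_eq_square)
  have "2 * E * D \<le> N ^ 4 * 1"
    using power_bound_mult[OF power_bound_mult[OF c1(2) v(4)] v(3)]
    by (simp add: eval_nat_numeral ac_simps)
  then have "n + 2 * E * D \<le> N ^ 5 * 1"
    using add[OF weaken[OF v(1), of 4 1]] by simp
  with M have M: "M \<le> N ^ 5 * 1" by simp
  have M2: "M + 2 \<le> N ^ 6 * 1" using add[OF M weaken[OF c1(2), of 5 1]] by simp
  then have M1: "M + 1 \<le> N ^ 6 * 1" by simp
  have n2: "n + 2 \<le> N ^ 2 * 1" and L2: "L + 2 \<le> N ^ 2 * 1" and D2: "D + 2 \<le> N ^ 2 * 1"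
    using add[OF v(1) c1(2)] add[OF v(2) c1(2)] add[OF v(3) c1(2)] by (simp_all add: numeral_2_eq_2)
  have E1: "E + 1 \<le> N ^ 3 * 1" using add[OF v(4) weaken[OF c1(1), of 2 1]] by (simp add: numeral_3_eq_3)
  have "Suc L \<le> N ^ 2 * 1" using L2 by simp
  from mult_le_mono1[OF power_bound_mult[OF v(1) this], of P]
  have "n * Suc L * P \<le> N ^ 3 * P" by (simp only: mult_1_right numeral_3_eq_3 numeral_2_eq_2 add_Suc_right add_0_right One_nat_def)
  then have "1 + n * Suc L * P \<le> N ^ 4 * P"
    using add[OF weaken[OF c1(1), of 3 P]] P by simp
  from power_bound_mult[OF this M] have "(1 + n * Suc L * P) * M \<le> N ^ 9 * P" by simp
  then have "1 + (1 + n * Suc L * P) * M \<le> N ^ 10 * P"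
    using add[OF weaken[OF c1(1), of 9 P]] P by simp
  with C have "C \<le> N ^ 10 * P" by simp
  then have C2: "C + 2 \<le> N ^ 11 * P"
    using add[OF _ weaken[OF c1(2), of 10 P]] P by simp
  have a: "1000 * (n + 2) \<le> N ^ 25 * P"
    using weaken[OF power_bound_mult[OF c1(6) n2], of 25 P] P by simp
  have b: "200 * (L + 2) * (M + 1) \<le> N ^ 25 * P"
    using weaken[OF power_bound_mult[OF power_bound_mult[OF c1(4) L2] M1], of 25 P] P by simp
  have c: "200 * (M + 2) * (C + 2) \<le> N ^ 26 * P"
    using weaken[OF power_bound_mult[OF power_bound_mult[OF c1(4) M2] C2], of 26 P] by simp
  have d: "100 \<le> N ^ 27 * P" using weaken[OF c1(3), of 27 P] P by simp
  have "1000 * (n + 2) + 200 * (L + 2) * (M + 1) \<le> N ^ 26 * P" using add[OF a b] by simp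
  from add[OF this c] have "1000 * (n + 2) + 200 * (L + 2) * (M + 1) + 200 * (M + 2) * (C + 2) \<le> N ^ 27 * P"
    by simp
  from add[OF this d]
  have "1000 * (n + 2) + 200 * (L + 2) * (M + 1) + 200 * (M + 2) * (C + 2) + 100 \<le> N ^ 28 * P"
    by simp
  from power_bound_mult[OF C2 this]
  have main: "(C + 2) * (1000 * (n + 2) + 200 * (L + 2) * (M + 1) + 200 * (M + 2) * (C + 2) + 100)
      \<le> N ^ 39 * (P * P)" by simp
  have e: "500 * (n + 1) \<le> N ^ 38 * (P * P)"
    using weaken[OF power_bound_mult[OF c1(5) n2], of 38 "P * P"] PP by simp
  have f: "500 * (E + 1) * (D + 2) \<le> N ^ 38 * (P * P)"
    using weaken[OF power_bound_mult[OF power_bound_mult[OF c1(5) E1] D2], of 38 "P * P"] PP by simp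
  from add[OF e f] have "500 * (n + 1) + 500 * (E + 1) * (D + 2) \<le> N ^ 39 * (P * P)" by simp
  from add[OF this main] show ?thesis by (simp add: power2_eq_square)
qed

lemma power_width_le: "(2 ^ w) ^ 2 \<le> (3 :: nat) ^ (2 * w ^ 3)"
proof -
  have "(2 ^ w) ^ 2 = (2 :: nat) ^ (2 * w)" by (simp add: power_mult[symmetric] mult.commute)
  also have "\<dots> \<le> 3 ^ (2 * w)" by (rule power_mono) auto
  also have "w \<le> w ^ 3" by (cases "w = 0") (auto intro: self_le_power)
  then have "(3 :: nat) ^ (2 * w) \<le> 3 ^ (2 * w ^ 3)" by (intro power_increasing) auto
  finally show ?thesis .
qed

section \<open>The arcs of an encoded instance, and the combined bound\<close>

lemma mem_set_edge_arcs: "(a, b, t) \<in> set (edge_arcs (u, v, ts)) \<longleftrightarrow> {a, b} = {u, v} \<and> t \<in> set ts"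
  by (auto simp: edge_arcs_def doubleton_eq_iff)

lemma length_edge_arcs: "length (edge_arcs (u, v, ts)) = 2 * length ts"
  unfolding edge_arcs_def by (induction ts) auto

theorem mainTheorem7:
  shows "\<exists>(c :: com) (a :: nat) (b :: nat).
    \<forall>(G :: nat temporal_graph) (xs :: nat list).
      is_temporal_graph G \<and> encodes xs G \<longrightarrow>
      (\<exists>t s. exec c (input_state xs) t s \<and>
        result s = (if has_temporal_hamiltonian_path G then 1 else 0) \<and>
        (time_edges G \<noteq> {} \<longrightarrow>
          t \<le> (card (vertices G) * lifetime G) ^ a * 3 ^ (b * TIM_width G ^ 3)))"
proof (rule exI[of _ "read_instance ;; search"], rule exI[of _ 40], rule exI[of _ 2], intro allI impI, elim conjE)
  fix G :: "nat temporal_graph" and xs :: "nat list"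
  assume G: "is_temporal_graph G" and "encodes xs G"
  then obtain n and es :: "edge list" where
    V: "vertices G = {..<n}" and
    edges: "edges G = (\<lambda>(u, v, ts). {u, v}) ` set es" and
    dist: "distinct (map (\<lambda>(u, v, ts). {u, v}) es)" and
    labels: "\<forall>(u, v, ts)\<in>set es. distinct ts \<and> set ts = labels G {u, v}" and
    xs: "xs = n # length es # concat (map edge_code es)"
    unfolding encodes_def edge_code_def by (elim exE conjE)
  define A where "A = source_arcs n @ concat (map edge_arcs es)"
  \<comment> \<open>The labels of an edge are distinct elements of \<open>{1..lifetime G}\<close>,
    so the lifetime bounds their number. The case distinction is due to \<open>lifetime G\<close>
    being unspecified without time-edges, when all label lists are empty.\<close>
  define D where "D = (if time_edges G = {} then 0 else lifetime G)"
  have te: "({a, b}, t) \<in> time_edges G \<longleftrightarrow> (\<exists>u v ts. (u, v, ts) \<in> set es \<and> {a, b} = {u, v} \<and> t \<in> set ts)" for a b t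
    using labels unfolding time_edges_def edges by fastforce
  have lenD: "length ts \<le> D" if e: "(u, v, ts) \<in> set es" for u v ts
  proof (cases "ts = []")
    case False
    have t: "({u, v}, t) \<in> time_edges G" if "t \<in> set ts" for t using te e that by blast
    then have "D = lifetime G" using False unfolding D_def by (metis empty_iff last_in_set)
    moreover have "set ts \<subseteq> {1..lifetime G}" using time_edge_le_lifetime(1)[OF G t] by blast
    then have "card (set ts) \<le> lifetime G" using card_mono[of "{1..lifetime G}"] by fastforce
    moreover have "distinct ts" using labels e by auto
    ultimately show ?thesis by (simp add: distinct_card)
  qed simp
  have setA: "set A = {(n, x, 0) |x. x < n} \<union> {(a, b, t). ({a, b}, t) \<in> time_edges G}"
  proof -
    have "set (source_arcs n) = {(n, x, 0) |x. x < n}" by (auto simp: source_arcs_def)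
    moreover have "(a, b, t) \<in> (\<Union>e\<in>set es. set (edge_arcs e)) \<longleftrightarrow> ({a, b}, t) \<in> time_edges G" for a b t
    proof -
      have "(a, b, t) \<in> (\<Union>e\<in>set es. set (edge_arcs e)) \<longleftrightarrow>
          (\<exists>u v ts. (u, v, ts) \<in> set es \<and> (a, b, t) \<in> set (edge_arcs (u, v, ts)))" by auto
      then show ?thesis unfolding te mem_set_edge_arcs .
    qed
    then have "set (concat (map edge_arcs es)) = {(a, b, t). ({a, b}, t) \<in> time_edges G}" by auto
    ultimately show ?thesis by (simp add: A_def)
  qed
  have instance_L: "temporal_instance G n A L" if "is_max_time A L" for L
  proof unfold_locales
    show "t \<le> L" if "(a, b, t) \<in> set A" for a b t
      using that \<open>is_max_time A L\<close> by (auto simp: is_max_time_def)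
  qed (fact G V setA)+
  have "run (read_instance ;; search) (input_state xs) (\<lambda>t s.
    result s = (if has_temporal_hamiltonian_path G then 1 else 0) \<and>
    (\<exists>L. is_max_time A L \<and> t \<le> 500 * (n + 1) + 500 * (length es + 1) * (D + 2) +
      (card (confs n A L) + 2) * (temporal_instance.body_bound n A L + 100)))"
    unfolding run_Seq
  proof (rule run_mono[OF run_read_instance[OF xs lenD]], assumption, elim conjE, goal_cases)
    case (1 t1 s1)
    then have "is_max_time A (s1 ''L'' 0)" unfolding A_def by blast
    interpret temporal_instance G n A "s1 ''L'' 0" by (rule instance_L) fact
    have "represents n A (s1 ''L'' 0) s1" using 1 unfolding A_def by blast
    show ?case
    proof (rule run_mono[OF run_search[OF \<open>represents n A (s1 ''L'' 0) s1\<close> 1(4)]], elim conjE, goal_cases)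
      case (1 t2 s2)
      then show ?case
        using \<open>is_max_time A (s1 ''L'' 0)\<close> \<open>t1 \<le> _\<close> by (intro conjI exI[of _ "s1 ''L'' 0"]) simp_all
    qed
  qed
  then obtain t s L where ex: "exec (read_instance ;; search) (input_state xs) t s"
    and res: "result s = (if has_temporal_hamiltonian_path G then 1 else 0)"
    and L: "is_max_time A L"
    and t: "t \<le> 500 * (n + 1) + 500 * (length es + 1) * (D + 2) +
      (card (confs n A L) + 2) * (temporal_instance.body_bound n A L + 100)"
    unfolding run_def by blast
  have "t \<le> (card (vertices G) * lifetime G) ^ 40 * 3 ^ (2 * TIM_width G ^ 3)" if ne: "time_edges G \<noteq> {}"
  proof -
    interpret temporal_instance G n A L by (rule instance_L) fact
    have L_eq: "L = lifetime G"
    proof (rule antisym)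
      show "L \<le> lifetime G" using L setA time_edgeD(5) unfolding is_max_time_def by fastforce
      have "lifetime G \<in> snd ` time_edges G"
        unfolding lifetime_def using ne finite_time_edges[OF G] by (intro Max_in) auto
      then obtain e where e: "(e, lifetime G) \<in> time_edges G" by auto
      then obtain a b where "e = {a, b}" using time_edge_le_lifetime(3)[OF G] by (metis card_2_iff)
      then have "(a, b, lifetime G) \<in> set A" using e setA by auto
      then show "lifetime G \<le> L" by (rule arc_time_le)
    qed
    obtain T :: "nat pair_pre_digraph" and B \<tau> where
      TIM: "TIM_decomposition G T B \<tau>" and width: "TIM_decomposition_width T B = TIM_width G"
      using TIM_width_attained[OF G ne] .
    interpret TIM_instance G n A L T B \<tau> by unfold_locales (fact TIM ne L_eq)+
    let ?N = "n * lifetime G" and ?P = "2 ^ TIM_width G :: nat"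
    obtain e r where "(e, r) \<in> time_edges G" using ne by auto
    then obtain a b where ab: "({a, b}, r) \<in> time_edges G"
      using time_edge_le_lifetime(3)[OF G] by (metis card_2_iff)
    \<comment> \<open>The two different ends of a time-edge and its positive time make
      \<open>?N\<close> at least 2, as absorbing constants into powers of \<open>?N\<close>
      requires.\<close>
    have "2 \<le> n" "1 \<le> lifetime G" using time_edgeD[OF ab] by auto
    then have N: "2 \<le> ?N" "n \<le> ?N" "lifetime G \<le> ?N" using mult_le_mono[of 2 n 1 "lifetime G"] by auto
    \<comment> \<open>Edges without labels are listed too, so the number of edges is bounded by
      pairs of vertices rather than through time-edges.\<close>
    have "length es = card (edges G)"
      unfolding edges using distinct_card[OF dist] by simp
    also have "edges G \<subseteq> (\<lambda>(a, b). {a, b}) ` ({..<n} \<times> {..<n})"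
    proof
      fix e assume "e \<in> edges G"
      then have "card e = 2" "e \<subseteq> {..<n}" using G V by (auto simp: is_temporal_graph_def)
      then obtain a b where "e = {a, b}" "a < n" "b < n" by (auto simp: card_2_iff)
      then show "e \<in> (\<lambda>(a, b). {a, b}) ` ({..<n} \<times> {..<n})" by auto
    qed
    then have "card (edges G) \<le> card ({..<n} \<times> {..<n})"
      by (intro surj_card_le) auto
    finally have E: "length es \<le> n * n" by simp
    also have "\<dots> \<le> ?N * ?N" using N(2) by (intro mult_le_mono)
    finally have E': "length es \<le> ?N * ?N" .
    have "length (concat (map edge_arcs es')) \<le> 2 * length es' * D" if "set es' \<subseteq> set es" for es'
      using that
    proof (induction es')
      case (Cons e es')
      obtain u v ts where e: "e = (u, v, ts)" by (cases e)
      then have "length (edge_arcs e) \<le> 2 * D" using lenD[of u v ts] Cons.prems by (simp add: length_edge_arcs)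
      then show ?case using Cons by (simp add: algebra_simps)
    qed simp
    then have M: "length A \<le> n + 2 * length es * D" by (simp add: A_def source_arcs_def)
    have "card (confs n A L) \<le> 1 + (1 + n * Suc L * ?P) * length A"
      using card_confs_le mult_le_mono1[OF card_good_confs_le, of "length A"] unfolding width by linarith
    from time_bound[OF N(1) _ N(2) _ E' _ M this] have
      "500 * (n + 1) + 500 * (length es + 1) * (D + 2) +
        (card (confs n A L) + 2) * (1000 * (n + 2) + 200 * (L + 2) * (length A + 1) +
          200 * (length A + 2) * (card (confs n A L) + 2) + 100) \<le> ?N ^ 40 * ?P ^ 2"
      using N(3) ne unfolding L_eq D_def by simp
    then have "t \<le> ?N ^ 40 * ?P ^ 2"
      using t unfolding body_bound_def by (rule order_trans[rotated])
    also have "\<dots> \<le> ?N ^ 40 * 3 ^ (2 * TIM_width G ^ 3)"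
      using power_width_le by (rule mult_le_mono2)
    finally show ?thesis by (simp add: V)
  qed
  with ex res show "\<exists>t s. exec (read_instance ;; search) (input_state xs) t s \<and>
      result s = (if has_temporal_hamiltonian_path G then 1 else 0) \<and>
      (time_edges G \<noteq> {} \<longrightarrow>
        t \<le> (card (vertices G) * lifetime G) ^ 40 * 3 ^ (2 * TIM_width G ^ 3))"
    by blast
qed

end
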